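(* Let $L_n$ ($n\in\mathbb{N}$) and $L$ be bounded linear operators on $\mathcal{H}_{\mathrm u}$ and $C_n,C:\mathcal{H}_{\mathrm r}\to\mathcal{H}_{\mathrm u}$ bounded linear operators. Assume $$L_n=L_n^*\ge0,\qquad L=L^*\ge0,\qquad\|L_n-L\|\to0,\qquad\|C_n-C\|\to0 .$$ Let $A$ generate a strongly continuous semigroup $S_A(t)$ on $\mathcal{H}_{\mathrm r}$ with $\|S_A(t)\|\le Me^{\omega t}$ for $t\ge 0$ ($M\ge1$, $\omega\in\mathbb{R}$), fix $T>0$, $F\in L^1(0,T;\mathcal{H}_{\mathrm r})$ and $x_0\in\mathcal{H}_{\mathrm r}$, and let $x_n,x$ be the mild solutions on $[0,T]$ of $$\frac{d}{dt}x_n=Ax_n-K_n*x_n+F,\qquad\frac{d}{dt}x=Ax-K*x+F,\qquad x_n(0)=x(0)=x_0,$$ where $K_n(t)=C_n^*e^{-tL_n}C_n$ and $K(t)=C^*e^{-tL}C$. Then, for every fixed $T>0$, $(L_n,C_n)$ is a structure-preserving stable reduction of $(L,C)$ on $[0,T]$. In particular, with $$q_n(t):=\int_0^te^{-(t-s)L_n}C_nx_n(s)\,ds,\qquad q(t):=\int_0^te^{-(t-s)L}Cx(s)\,ds,$$ one has $x_n\to x$ in $\mathcal{C}([0,T];\mathcal{H}_{\mathrm r})$, $q_n\to q$ in $\mathcal{C}([0,T];\mathcal{H}_{\mathrm u})$, and $$\frac12\|q_n(T)\|_{\mathcal{H}_{\mathrm u}}^2+\int_0^T\|L_n^{1/2}q_n(t)\|_{\mathcal{H}_{\mathrm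 u}}^2\,dt\longrightarrow\frac12\|q(T)\|_{\mathcal{H}_{\mathrm u}}^2+\int_0^T\|L^{1/2}q(t)\|_{\mathcal{H}_{\mathrm u}}^2\,dt .$$
   Context: $\mathcal{H}_{\mathrm r}$ and $\mathcal{H}_{\mathrm u}$ are separable real Hilbert spaces; operator norms are written $\|\cdot\|$; $(K*x)(t):=\int_0^tK(t-s)x(s)\,ds$. The mild solution of $x'=Ax-K*x+F$, $x(0)=x_0$ is the function $x\in\mathcal{C}([0,T];\mathcal{H}_{\mathrm r})$ with $x(t)=S_A(t)x_0+\int_0^tS_A(t-s)\{F(s)-(K*x)(s)\}\,ds$. Definition (structure-preserving stable reduction). Let $L$ be bounded self-adjoint non-negative on $\mathcal{H}_{\mathrm u}$, $C:\mathcal{H}_{\mathrm r}\to\mathcal{H}_{\mathrm u}$ bounded, and let $(L_n,C_n)$ be a family of bounded operators $L_n$ on $\mathcal{H}_{\mathrm u}$ and $C_n:\mathcal{H}_{\mathrm r}\to\mathcal{H}_{\mathrm u}$, with kernels $K_n(t)=C_n^*e^{-tL_n}C_n$, $K(t)=C^*e^{-tL}C$. For the fixed $A,F,x_0$, let $x_n,x,q_n,q$ be defined by the equations and formulas displayed in the claim. The family is a structure-preserving stable reduction on $[0,T]$ of $(L,C)$ if: (P1) each $L_n$ is self-adjoint and non-negative, and the feedback is represented by the adjoint pair $C_n^*,C_n$; (P2) $x_n\to x$ in $\mathcal{C}([0,T];\mathcal{H}_{\mathrm r})$ and $q_n\to q$ in $\mathcal{C}([0,T];\mathcal{H}_{\mathrm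 u})$; (P3) the memory storage–dissipation functional converges: $\frac12\|q_n(T)\|^2+\int_0^T\|L_n^{1/2}q_n(t)\|^2dt\to\frac12\|q(T)\|^2+\int_0^T\|L^{1/2}q(t)\|^2dt$. *)

theory Defs
  imports "HOL-Analysis.Analysis"
begin

text \<open>
  Separable real Hilbert spaces are types of sort \<open>{real_inner, banach, second_countable_topology}\<close>,
  bounded operators are elements of the type \<open>'a \<Rightarrow>\<^sub>L 'b\<close>, and \<open>C\<^sup>*\<close> is the library's \<open>adjoint\<close>.
  All integrals are Bochner integrals with respect to Lebesgue measure.
\<close>

definition selfadjoint_nonneg :: "('a::real_inner \<Rightarrow>\<^sub>L 'a) \<Rightarrow> bool" where
  "selfadjoint_nonneg L \<longleftrightarrow>
     adjoint (blinfun_apply L) = blinfun_apply L \<and> (\<forall>u. 0 \<le> blinfun_apply L u \<bullet> u)"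

text \<open>
  \<open>adjoint\<close> is defined by Hilbert choice; the following says that the chosen map \<open>B\<close> really is
  the bounded operator adjoint to \<open>C\<close>.
\<close>

definition adjoint_pair :: "('b::real_inner \<Rightarrow> 'a::real_inner) \<Rightarrow> ('a \<Rightarrow>\<^sub>L 'b) \<Rightarrow> bool" where
  "adjoint_pair B C \<longleftrightarrow>
     bounded_linear B \<and> (\<forall>x u. blinfun_apply C x \<bullet> u = x \<bullet> B u)"

text \<open>The non-negative self-adjoint square root \<open>L\<^sup>1\<^sup>/\<^sup>2\<close> (unique for \<open>L = L\<^sup>* \<ge> 0\<close>).\<close>

definition op_sqrt :: "('a::real_inner \<Rightarrow>\<^sub>L 'a) \<Rightarrow> ('a \<Rightarrow>\<^sub>L 'a)" where
  "op_sqrt L = (THE R. selfadjoint_nonneg R \<and> R o\<^sub>L R = L)"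

text \<open>
  The type of bounded operators is not an instance of \<open>real_normed_algebra_1\<close>, so the library's
  \<open>exp\<close> does not apply; this is the same power series, converging in operator norm.
\<close>

definition op_exp :: "('a::real_normed_vector \<Rightarrow>\<^sub>L 'a) \<Rightarrow> ('a \<Rightarrow>\<^sub>L 'a)" where
  "op_exp L = (\<Sum>n. ((\<lambda>R. L o\<^sub>L R) ^^ n) id_blinfun /\<^sub>R fact n)"

text \<open>Semigroups are families indexed by \<open>real\<close>; only their values at times \<open>t \<ge> 0\<close> matter.\<close>

definition C0_semigroup :: "(real \<Rightarrow> ('a::real_normed_vector \<Rightarrow>\<^sub>L 'a)) \<Rightarrow> bool" where
  "C0_semigroup S \<longleftrightarrow>
     S 0 = id_blinfun \<and>
     (\<forall>s\<ge>0. \<forall>t\<ge>0. S (s + t) = S s o\<^sub>L S t) \<and>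
     (\<forall>x. continuous_on {0..} (\<lambda>t. blinfun_apply (S t) x))"

text \<open>The unbounded operator \<open>A\<close> is given by its domain \<open>D\<close> and its values on \<open>D\<close>.\<close>

definition generates ::
  "'a set \<Rightarrow> ('a \<Rightarrow> 'a) \<Rightarrow> (real \<Rightarrow> ('a::real_normed_vector \<Rightarrow>\<^sub>L 'a)) \<Rightarrow> bool" where
  "generates D A S \<longleftrightarrow>
     C0_semigroup S \<and>
     D = {x. \<exists>y. ((\<lambda>h. (blinfun_apply (S h) x - x) /\<^sub>R h) \<longlongrightarrow> y) (at_right 0)} \<and>
     (\<forall>x\<in>D. ((\<lambda>h. (blinfun_apply (S h) x - x) /\<^sub>R h) \<longlongrightarrow> A x) (at_right 0))"

definition memory_kernel ::
  "('u::{real_inner,banach} \<Rightarrow>\<^sub>L 'u) \<Rightarrow> ('r::real_inner \<Rightarrow>\<^sub>L 'u) \<Rightarrow> real \<Rightarrow> 'r \<Rightarrow> 'r" where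
  "memory_kernel L C t =
     adjoint (blinfun_apply C) \<circ> blinfun_apply (op_exp (- (t *\<^sub>R L))) \<circ> blinfun_apply C"

definition convolution ::
  "(real \<Rightarrow> 'r \<Rightarrow> 'r) \<Rightarrow> (real \<Rightarrow> 'r) \<Rightarrow> real \<Rightarrow> 'r::{banach,second_countable_topology}" where
  "convolution K x t = (LINT s:{0..t}|lebesgue. K (t - s) (x s))"

text \<open>
  Mild solution on \<open>[0,T]\<close> of \<open>x' = A x - K * x + F\<close>, \<open>x 0 = x0\<close>, with \<open>S\<close> the semigroup generated
  by \<open>A\<close>. Functions on \<open>[0,T]\<close> are represented by functions on \<open>real\<close> with arbitrary values
  elsewhere.
\<close>

definition mild_solution ::
  "(real \<Rightarrow> ('r \<Rightarrow>\<^sub>L 'r)) \<Rightarrow> (real \<Rightarrow> 'r \<Rightarrow> 'r) \<Rightarrow> (real \<Rightarrow> 'r) \<Rightarrow> 'r \<Rightarrow> real \<Rightarrow>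
    (real \<Rightarrow> 'r::{banach,second_countable_topology}) \<Rightarrow> bool" where
  "mild_solution S K F x0 T x \<longleftrightarrow>
     continuous_on {0..T} x \<and>
     (\<forall>t\<in>{0..T}. x t = blinfun_apply (S t) x0 +
        (LINT s:{0..t}|lebesgue. blinfun_apply (S (t - s)) (F s - convolution K x s)))"

definition memory_state ::
  "('u \<Rightarrow>\<^sub>L 'u) \<Rightarrow> ('r::real_normed_vector \<Rightarrow>\<^sub>L 'u) \<Rightarrow> (real \<Rightarrow> 'r) \<Rightarrow> real \<Rightarrow>
    'u::{banach,second_countable_topology}" where
  "memory_state L C x t =
     (LINT s:{0..t}|lebesgue. blinfun_apply (op_exp (- ((t - s) *\<^sub>R L))) (blinfun_apply C (x s)))"

definition storage_dissipation ::
  "('u::real_inner \<Rightarrow>\<^sub>L 'u) \<Rightarrow> real \<Rightarrow> (real \<Rightarrow> 'u) \<Rightarrow> real" where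
  "storage_dissipation L T q =
     1 / 2 * (norm (q T))\<^sup>2 + (LINT t:{0..T}|lebesgue. (norm (blinfun_apply (op_sqrt L) (q t)))\<^sup>2)"

definition converges_in_C ::
  "real \<Rightarrow> (nat \<Rightarrow> real \<Rightarrow> 'a::real_normed_vector) \<Rightarrow> (real \<Rightarrow> 'a) \<Rightarrow> bool" where
  "converges_in_C T fs f \<longleftrightarrow>
     (\<forall>n. continuous_on {0..T} (fs n)) \<and> continuous_on {0..T} f \<and>
     uniform_limit {0..T} fs f sequentially"

text \<open>
  The trajectories are determined by the data on \<open>[0,T]\<close> only, so the convergences are required for
  every choice of representatives; the two existence clauses exclude vacuous truth. That the feedback
  uses the adjoint pair is built into the kernels \<open>memory_kernel (Ls n) (Cs n)\<close>, and the clause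
  \<open>adjoint_pair\<close> adds that the maps occurring there are genuine adjoints.
\<close>

definition structure_preserving_stable_reduction ::
  "(real \<Rightarrow> ('r \<Rightarrow>\<^sub>L 'r)) \<Rightarrow> (real \<Rightarrow> 'r) \<Rightarrow> 'r \<Rightarrow> real \<Rightarrow>
    (nat \<Rightarrow> ('u \<Rightarrow>\<^sub>L 'u)) \<Rightarrow> (nat \<Rightarrow> ('r \<Rightarrow>\<^sub>L 'u)) \<Rightarrow>
    ('u::{real_inner,banach,second_countable_topology} \<Rightarrow>\<^sub>L 'u) \<Rightarrow>
    ('r::{real_inner,banach,second_countable_topology} \<Rightarrow>\<^sub>L 'u) \<Rightarrow> bool" where
  "structure_preserving_stable_reduction S F x0 T Ls Cs L C \<longleftrightarrow>
     selfadjoint_nonneg L \<and>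
     (\<forall>n. selfadjoint_nonneg (Ls n) \<and> adjoint_pair (adjoint (blinfun_apply (Cs n))) (Cs n)) \<and>
     (\<forall>n. \<exists>y. mild_solution S (memory_kernel (Ls n) (Cs n)) F x0 T y) \<and>
     (\<exists>y. mild_solution S (memory_kernel L C) F x0 T y) \<and>
     (\<forall>xs x.
        (\<forall>n. mild_solution S (memory_kernel (Ls n) (Cs n)) F x0 T (xs n)) \<longrightarrow>
        mild_solution S (memory_kernel L C) F x0 T x \<longrightarrow>
        converges_in_C T xs x \<and>
        converges_in_C T (\<lambda>n. memory_state (Ls n) (Cs n) (xs n)) (memory_state L C x) \<and>
        (\<lambda>n. storage_dissipation (Ls n) T (memory_state (Ls n) (Cs n) (xs n)))
          \<longlonglongrightarrow> storage_dissipation L T (memory_state L C x))"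

end

theory Submission
  imports Defs
begin

text \<open>
  The convolution term is \<open>K * x = C\<^sup>* q\<close> with \<open>q\<close> the memory state, and \<open>L \<mapsto> exp (- t L)\<close> is
  Lipschitz in operator norm, uniformly for \<open>t\<close> in \<open>[0,T]\<close> and bounded \<open>L\<close>. Subtracting the two
  Duhamel formulas, \<open>\<parallel>x\<^sub>n - x\<parallel>\<close> is bounded by a term vanishing with
  \<open>\<parallel>L\<^sub>n - L\<parallel> + \<parallel>C\<^sub>n - C\<parallel>\<close> plus a multiple of its own integral, so Gronwall's inequality
  gives uniform convergence of \<open>x\<^sub>n\<close>, and with it that of \<open>q\<^sub>n\<close>. The square roots
  never have to be compared: \<open>\<parallel>L\<^sup>1\<^sup>/\<^sup>2 q\<parallel>\<^sup>2 = L q \<bullet> q\<close>, which passes to the uniform limit.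
\<close>

text \<open>\<open>adjoint\<close> is a \<open>SOME\<close> and \<open>op_sqrt\<close> a
  \<open>THE\<close>, so neither carries information until an adjoint is known to exist and the
  non-negative root is known to exist and be unique. This is why a convergence theorem starts with
  Riesz representation and square roots of bounded operators. When two trajectories are compared,
  every difference is split so that the errors in \<open>L\<close> and \<open>C\<close> act on the
  limit trajectory, while the operators of index n act only on the difference of the trajectories.
  The constants then involve sup norms of the limit alone, so x_n needs no bound of its own
  beforehand. The memory turns the Duhamel difference into a nested integral; since the norm of x_n
  - x is non-negative, the inner integral is monotone in its upper limit, and a single integral
  remains for Gronwall.\<close>

section \<open>Adjoints\<close>

text \<open>The representing vector minimises \<open>x \<bullet> x - 2 * f x\<close>; the parallelogram law makes every
  minimising sequence Cauchy.\<close>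

lemma riesz_representation:
  fixes f :: "'a::{real_inner,banach} \<Rightarrow> real"
  assumes f: "bounded_linear f"
  shows "\<exists>y. \<forall>x. f x = x \<bullet> y"
proof -
  interpret bounded_linear f by (fact f)
  define J where "J x = x \<bullet> x - 2 * f x" for x
  obtain K where K: "\<And>x. norm (f x) \<le> norm x * K"
    using bounded by blast
  have J_lower: "- (K\<^sup>2) \<le> J x" for x
  proof -
    have "2 * f x \<le> 2 * (norm x * K)"
      using K[of x] by simp
    moreover have "0 \<le> (norm x - K)\<^sup>2"
      by simp
    ultimately show ?thesis
      unfolding J_def by (simp add: power2_norm_eq_inner[symmetric] power2_eq_square algebra_simps)
  qed
  define m where "m = (INF x. J x)"
  have bdd: "bdd_below (range J)"
    using J_lower by (intro bdd_belowI2)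
  have m_le: "m \<le> J x" for x
    unfolding m_def using bdd by (intro cINF_lower) auto
  define r where "r n = inverse (real (Suc n))" for n
  have "\<exists>x. J x < m + r n" for n
    using cINF_less_iff[OF _ bdd, of "m + r n"] by (auto simp: m_def r_def)
  then obtain X where X: "\<And>n. J (X n) < m + r n"
    by metis
  \<comment> \<open>The linear parts of \<open>J\<close> cancel in this combination. Bounding the
    midpoint value below by \<open>m\<close> then shows that two almost-minimisers are
    close.\<close>
  have par: "(norm (x - y))\<^sup>2 = 2 * (J x + J y - 2 * J ((1/2) *\<^sub>R (x + y)))" for x y
    unfolding J_def power2_norm_eq_inner
    by (simp add: add scaleR inner_simps inner_commute algebra_simps)
  have X_dist: "(norm (X i - X j))\<^sup>2 \<le> 2 * (r i + r j)" for i j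
    unfolding par using X[of i] X[of j] m_le[of "(1/2) *\<^sub>R (X i + X j)"] by argo
  have "Cauchy X"
  proof (rule CauchyI)
    fix e :: real
    assume "0 < e"
    then obtain N where N: "r N < e\<^sup>2 / 4"
      using reals_Archimedean[of "e\<^sup>2 / 4"] by (auto simp: r_def)
    have "norm (X i - X j) < e" if "i \<ge> N" "j \<ge> N" for i j
    proof -
      have "r i \<le> r N"
        "r j \<le> r N"
        using that by (auto simp: r_def intro!: le_imp_inverse_le)
      then have "(norm (X i - X j))\<^sup>2 < e\<^sup>2"
        using N by (intro le_less_trans[OF X_dist[of i j]]) argo
      then show ?thesis
        using \<open>0 < e\<close> by (simp add: power2_less_imp_less)
    qed
    then show "\<exists>N. \<forall>i\<ge>N. \<forall>j\<ge>N. norm (X i - X j) < e"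
      by blast
  qed
  then obtain y where y: "X \<longlonglongrightarrow> y"
    using Cauchy_convergent_iff convergent_def by blast
  have "(\<lambda>n. J (X n)) \<longlonglongrightarrow> J y"
    unfolding J_def by (intro tendsto_intros tendsto y)
  moreover have "(\<lambda>n. m + r n) \<longlonglongrightarrow> m + 0"
    unfolding r_def by (intro tendsto_intros LIMSEQ_inverse_real_of_nat)
  ultimately have "J y \<le> m + 0"
    using X by (intro LIMSEQ_le) (auto intro: less_imp_le)
  then have min: "J y \<le> J x" for x
    using m_le[of x] by simp
  have "f x = x \<bullet> y" for x
  proof (cases "x = 0")
    case False
    \<comment> \<open>This value minimises the quadratic polynomial
      \<open>J (y + t *\<^sub>R x)\<close> in \<open>t\<close>. The minimum lies below
      \<open>J y\<close> by the square of the defect \<open>f x - x \<bullet> y\<close> over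
      \<open>x \<bullet> x\<close>, so minimality of \<open>y\<close> forces the defect to
      vanish.\<close>
    define t where "t = (f x - x \<bullet> y) / (x \<bullet> x)"
    have "0 < x \<bullet> x"
      using False by simp
    have "J (y + t *\<^sub>R x) - J y = - (f x - x \<bullet> y)\<^sup>2 / (x \<bullet> x)"
      using \<open>0 < x \<bullet> x\<close> unfolding J_def t_def
      by (simp add: add scaleR inner_simps inner_commute power2_eq_square field_simps)
    with min[of "y + t *\<^sub>R x"] have "(f x - x \<bullet> y)\<^sup>2 / (x \<bullet> x) \<le> 0"
      by simp
    then have "(f x - x \<bullet> y)\<^sup>2 \<le> 0"
      using \<open>0 < x \<bullet> x\<close> by (simp only: divide_le_0_iff) simp
    then show ?thesis
      by simp
  qed (simp add: zero)
  then show ?thesis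
    by blast
qed

text \<open>The choice inside \<open>adjoint\<close> is meaningful only if a candidate exists. For
  each \<open>u\<close>, Riesz representation of the functional
  \<open>\<lambda>x. C x \<bullet> u\<close> supplies its value.\<close>

lemma inner_adjoint:
  fixes C :: "'a::{real_inner,banach} \<Rightarrow>\<^sub>L 'b::real_inner"
  shows "C x \<bullet> u = x \<bullet> adjoint C u"
proof -
  have "\<exists>y. \<forall>x. C x \<bullet> u = x \<bullet> y" for u
    by (intro riesz_representation bounded_linear_intros)
  then have "\<exists>B. \<forall>x u. C x \<bullet> u = x \<bullet> B u"
    by metis
  then show ?thesis
    unfolding adjoint_def by (rule someI2_ex) simp
qed

lemma norm_adjoint_le:
  fixes C :: "'a::{real_inner,banach} \<Rightarrow>\<^sub>L 'b::real_inner"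
  shows "norm (adjoint C u) \<le> norm C * norm u"
proof -
  have "norm (adjoint C u) * norm (adjoint C u) = C (adjoint C u) \<bullet> u"
    unfolding inner_adjoint by (simp add: dot_square_norm power2_eq_square)
  also have "\<dots> \<le> norm (C (adjoint C u)) * norm u"
    by (rule norm_cauchy_schwarz)
  also have "\<dots> \<le> (norm C * norm (adjoint C u)) * norm u"
    by (intro mult_right_mono norm_blinfun) simp
  also have "\<dots> = (norm C * norm u) * norm (adjoint C u)"
    by simp
  finally show ?thesis
    by (cases "norm (adjoint C u) = 0") auto
qed

lemma bounded_linear_adjoint:
  fixes C :: "'a::{real_inner,banach} \<Rightarrow>\<^sub>L 'b::real_inner"
  shows "bounded_linear (adjoint C)"
proof (rule bounded_linear_intro)
  show "adjoint C (u + v) = adjoint C u + adjoint C v" for u v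
    by (rule vector_eq_ldot[THEN iffD1]) (simp add: inner_add_right flip: inner_adjoint)
  show "adjoint C (r *\<^sub>R u) = r *\<^sub>R adjoint C u" for r u
    by (rule vector_eq_ldot[THEN iffD1]) (simp flip: inner_adjoint)
  show "norm (adjoint C u) \<le> norm u * norm C" for u
    using norm_adjoint_le[of C u] by (simp add: mult.commute)
qed

text \<open>As an element of the operator type, the adjoint becomes subject to the rules for
  differences and continuity of bounded operators.\<close>

definition blinfun_adjoint ::
    "('a::{real_inner,banach} \<Rightarrow>\<^sub>L 'b::real_inner) \<Rightarrow> ('b \<Rightarrow>\<^sub>L 'a)" where
  "blinfun_adjoint C = Blinfun (adjoint C)"

lemma blinfun_adjoint_apply [simp]: "blinfun_adjoint C u = adjoint C u"
  unfolding blinfun_adjoint_def by (simp add: bounded_linear_Blinfun_apply bounded_linear_adjoint)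

lemma blinfun_adjoint_diff: "blinfun_adjoint (B - C) = blinfun_adjoint B - blinfun_adjoint C"
proof (rule blinfun_eqI)
  show "blinfun_adjoint (B - C) u = (blinfun_adjoint B - blinfun_adjoint C) u" for u
    by (rule vector_eq_ldot[THEN iffD1])
      (simp add: blinfun.diff_left inner_diff_right inner_diff_left flip: inner_adjoint)
qed

lemma adjoint_pair_adjoint:
  fixes C :: "'a::{real_inner,banach} \<Rightarrow>\<^sub>L 'b::real_inner"
  shows "adjoint_pair (adjoint C) C"
  unfolding adjoint_pair_def using bounded_linear_adjoint inner_adjoint by blast

section \<open>The positive square root\<close>

lemma selfadjoint_nonneg_iff:
  fixes L :: "'a::{real_inner,banach} \<Rightarrow>\<^sub>L 'a"
  shows "selfadjoint_nonneg L \<longleftrightarrow> (\<forall>u v. L u \<bullet> v = u \<bullet> L v) \<and> (\<forall>u. 0 \<le> L u \<bullet> u)"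
  unfolding selfadjoint_nonneg_def
  by (metis adjoint_unique inner_adjoint)

text \<open>Expand the non-negative quantity \<open>L v \<bullet> v\<close> at
  \<open>v = c *\<^sub>R u - L u\<close>. With \<open>c = 1\<close> the estimate gives
  \<open>norm (id_blinfun - L) \<le> 1\<close> for a contraction \<open>L\<close>; when
  \<open>L u \<bullet> u = 0\<close> it gives \<open>L u = 0\<close>, on which uniqueness of the
  root rests.\<close>

lemma norm_square_le_inner:
  fixes L :: "'a::{real_inner,banach} \<Rightarrow>\<^sub>L 'a"
  assumes L: "selfadjoint_nonneg L" and c: "norm L \<le> c"
  shows "(norm (L u))\<^sup>2 \<le> c * (L u \<bullet> u)"
proof (cases "c = 0")
  case False
  then have "0 < c"
    using c norm_ge_zero[of L] by linarith
  have sym: "L u \<bullet> v = u \<bullet> L v" and pos: "0 \<le> L u \<bullet> u" for u v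
    using L unfolding selfadjoint_nonneg_iff by auto
  have "L (L u) \<bullet> L u \<le> norm (L (L u)) * norm (L u)"
    by (rule norm_cauchy_schwarz)
  also have "\<dots> \<le> (c * norm (L u)) * norm (L u)"
    using norm_blinfun[of L "L u"] mult_right_mono[OF c norm_ge_zero[of "L u"]]
    by (intro mult_right_mono) auto
  finally have 1: "L (L u) \<bullet> L u \<le> c * (norm (L u))\<^sup>2"
    by (simp add: power2_eq_square)
  have "0 \<le> L (c *\<^sub>R u - L u) \<bullet> (c *\<^sub>R u - L u)"
    by (rule pos)
  also have "\<dots> = c * (c * (L u \<bullet> u)) - 2 * (c * (norm (L u))\<^sup>2) + L (L u) \<bullet> L u"
    using sym[of "L u" u]
    by (simp add: blinfun.bilinear_simps inner_simps power2_norm_eq_inner algebra_simps)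
  finally have "c * (norm (L u))\<^sup>2 \<le> c * (c * (L u \<bullet> u))"
    using 1 by linarith
  then show ?thesis
    using \<open>0 < c\<close> by simp
qed (use c in simp)

text \<open>The square root of \<open>L\<close> with \<open>0 \<le> L \<le> 1\<close> is \<open>1 - Y\<close>, where \<open>Y\<close> is the limit of this iteration
  for \<open>B = 1 - L\<close>; it solves \<open>Y = (B + Y\<^sup>2) / 2\<close>.\<close>

fun sqrt_iter :: "('a::real_normed_vector \<Rightarrow>\<^sub>L 'a) \<Rightarrow> nat \<Rightarrow> ('a \<Rightarrow>\<^sub>L 'a)" where
  "sqrt_iter B 0 = 0"
| "sqrt_iter B (Suc n) = (1/2) *\<^sub>R (B + (sqrt_iter B n o\<^sub>L sqrt_iter B n))"

text \<open>The scalar iteration for \<open>B = 1\<close>, a majorant of the operator iteration.\<close>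

fun sqrt_majorant :: "nat \<Rightarrow> real" where
  "sqrt_majorant 0 = 0"
| "sqrt_majorant (Suc n) = (1 + sqrt_majorant n * sqrt_majorant n) / 2"

lemma sqrt_majorant_bounds: "0 \<le> sqrt_majorant n \<and> sqrt_majorant n \<le> 1"
proof (induction n)
  case (Suc n)
  then have "sqrt_majorant n * sqrt_majorant n \<le> 1 * 1"
    by (intro mult_mono) auto
  with Suc show ?case
    by simp
qed simp

lemma sqrt_majorant_Suc_ge: "sqrt_majorant n \<le> sqrt_majorant (Suc n)"
proof -
  have "0 \<le> (1 - sqrt_majorant n) * (1 - sqrt_majorant n)"
    by simp
  then show ?thesis
    by (simp add: algebra_simps)
qed

lemma norm_blinfun_compose_le:
  assumes "norm f \<le> a" "norm g \<le> b"
  shows "norm (f o\<^sub>L g) \<le> a * b"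
proof -
  have "norm (f o\<^sub>L g) \<le> norm f * norm g"
    by (rule norm_blinfun_compose)
  also have "\<dots> \<le> a * b"
    using assms order_trans[OF norm_ge_zero assms(1)] by (intro mult_mono) auto
  finally show ?thesis .
qed

lemma blinfun_compose_left_diff: "(f o\<^sub>L g) - (f o\<^sub>L h) = f o\<^sub>L (g - h)"
  and blinfun_compose_right_diff: "(g o\<^sub>L f') - (h o\<^sub>L f') = (g - h) o\<^sub>L f'"
  by (auto intro!: blinfun_eqI simp: blinfun.bilinear_simps)

context
  fixes B :: "'a::banach \<Rightarrow>\<^sub>L 'a"
  assumes norm_B: "norm B \<le> 1"
begin

lemma norm_sqrt_iter_le: "norm (sqrt_iter B n) \<le> sqrt_majorant n"
proof (induction n)
  case (Suc n)
  have "norm (sqrt_iter B n o\<^sub>L sqrt_iter B n) \<le> sqrt_majorant n * sqrt_majorant n"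
    by (intro norm_blinfun_compose_le Suc.IH)
  then show ?case
    using norm_triangle_le[of B "sqrt_iter B n o\<^sub>L sqrt_iter B n"] norm_B by simp
qed simp

text \<open>Every iterate is a polynomial in \<open>B\<close>. The limit inherits the commutation,
  which enters the uniqueness proof for the square root.\<close>

lemma sqrt_iter_commute:
  "B o\<^sub>L R = R o\<^sub>L B \<Longrightarrow> sqrt_iter B n o\<^sub>L R = R o\<^sub>L sqrt_iter B n"
proof (induction n)
  case (Suc n)
  have c: "B (R u) = R (B u)" for u
    using Suc.prems by (metis blinfun_apply_blinfun_compose)
  have c': "sqrt_iter B n (R u) = R (sqrt_iter B n u)" for u
    using Suc.IH[OF Suc.prems] by (metis blinfun_apply_blinfun_compose)
  show ?case
    by (rule blinfun_eqI) (simp add: blinfun.bilinear_simps c c')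
qed simp

text \<open>The splitting \<open>Y Y - Z Z = Y (Y - Z) + (Y - Z) Z\<close> holds without
  commutativity, and bounding it factor by factor reproduces exactly the same identity for the
  majorant.\<close>

lemma norm_sqrt_iter_step:
  "norm (sqrt_iter B (Suc n) - sqrt_iter B n) \<le> sqrt_majorant (Suc n) - sqrt_majorant n"
proof (induction n)
  case 0
  then show ?case using norm_B by simp
next
  case (Suc n)
  let ?Y = "sqrt_iter B (Suc n)" and ?Z = "sqrt_iter B n"
  let ?y = "sqrt_majorant (Suc n)" and ?z = "sqrt_majorant n"
  have "sqrt_iter B (Suc (Suc n)) - ?Y = (1/2) *\<^sub>R ((?Y o\<^sub>L ?Y) - (?Z o\<^sub>L ?Z))"
    by (simp del: sqrt_iter.simps(2) add: sqrt_iter.simps(2)[of B "Suc n"]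
        sqrt_iter.simps(2)[of B n] scaleR_add_right scaleR_diff_right)
  also have "\<dots> = (1/2) *\<^sub>R ((?Y o\<^sub>L (?Y - ?Z)) + ((?Y - ?Z) o\<^sub>L ?Z))"
    by (simp del: sqrt_iter.simps flip: blinfun_compose_left_diff blinfun_compose_right_diff)
  also have "norm \<dots> \<le> (?y * (?y - ?z) + (?y - ?z) * ?z) / 2"
    using norm_triangle_mono[OF
        norm_blinfun_compose_le[OF norm_sqrt_iter_le[of "Suc n"] Suc.IH]
        norm_blinfun_compose_le[OF Suc.IH norm_sqrt_iter_le[of n]]]
    by (simp del: sqrt_iter.simps sqrt_majorant.simps)
  also have "\<dots> = sqrt_majorant (Suc (Suc n)) - ?y"
    by (simp del: sqrt_majorant.simps add: sqrt_majorant.simps(2)[of "Suc n"]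
        sqrt_majorant.simps(2)[of n] field_simps)
  finally show ?case .
qed

text \<open>The majorant approaches its limit without a geometric rate, so a contraction argument is
  not at hand. Being monotone and bounded, it still has increments with a convergent telescoping
  sum, and these dominate the operator increments.\<close>

lemma convergent_sqrt_iter: "convergent (sqrt_iter B)"
proof -
  have "convergent sqrt_majorant"
  proof (rule Bseq_monoseq_convergent)
    show "Bseq sqrt_majorant"
      using sqrt_majorant_bounds by (intro BseqI'[of _ 1]) simp
    show "monoseq sqrt_majorant"
      using sqrt_majorant_Suc_ge by (simp add: monoseq_Suc del: sqrt_majorant.simps)
  qed
  then have "summable (\<lambda>n. sqrt_majorant (Suc n) - sqrt_majorant n)"
    using telescope_summable convergent_def by blast
  then have "summable (\<lambda>n. sqrt_iter B (Suc n) - sqrt_iter B n)"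
    by (rule summable_comparison_test'[of _ 0]) (rule norm_sqrt_iter_step)
  then have "convergent (\<lambda>n. \<Sum>k<n. sqrt_iter B (Suc k) - sqrt_iter B k)"
    by (simp add: summable_iff_convergent del: sqrt_iter.simps)
  then show ?thesis
    by (simp add: sum_lessThan_telescope del: sqrt_iter.simps(2))
qed

end

lemma sqrt_iter_selfadjoint:
  fixes B :: "'a::real_inner \<Rightarrow>\<^sub>L 'a"
  assumes "\<And>u v. B u \<bullet> v = u \<bullet> B v"
  shows "sqrt_iter B n u \<bullet> v = u \<bullet> sqrt_iter B n v"
  by (induction n arbitrary: u v) (simp_all add: blinfun.bilinear_simps inner_simps assms)

text \<open>The fixed-point equation for \<open>Y\<close> says that the square of
  \<open>1 - Y\<close> is \<open>1 - B = L\<close>, and \<open>norm Y \<le> 1\<close> makes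
  \<open>1 - Y\<close> non-negative. The commutation clause is carried along because
  \<open>ex1_sqrt\<close> compares this root with an arbitrary other one.\<close>

lemma ex_sqrt_contraction:
  fixes L :: "'a::{real_inner,banach} \<Rightarrow>\<^sub>L 'a"
  assumes L: "selfadjoint_nonneg L" and norm_L: "norm L \<le> 1"
  shows "\<exists>R. selfadjoint_nonneg R \<and> R o\<^sub>L R = L \<and> (\<forall>Q. L o\<^sub>L Q = Q o\<^sub>L L \<longrightarrow> R o\<^sub>L Q = Q o\<^sub>L R)"
proof -
  define B where "B = id_blinfun - L"
  have sym: "L u \<bullet> v = u \<bullet> L v" and pos: "0 \<le> L u \<bullet> u" for u v
    using L unfolding selfadjoint_nonneg_iff by auto
  have "norm B \<le> 1"
  proof (rule norm_blinfun_bound)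
    fix u
    have "(norm (B u))\<^sup>2 = (norm u)\<^sup>2 - 2 * (L u \<bullet> u) + (norm (L u))\<^sup>2"
      by (simp add: B_def blinfun.bilinear_simps power2_norm_eq_inner inner_simps inner_commute)
    also have "\<dots> \<le> (norm u)\<^sup>2"
      using norm_square_le_inner[OF L norm_L, of u] pos[of u] by simp
    finally show "norm (B u) \<le> 1 * norm u"
      by (simp add: power2_le_iff_abs_le)
  qed simp
  then obtain Y where Y: "sqrt_iter B \<longlonglongrightarrow> Y"
    using convergent_sqrt_iter convergent_def by blast
  have symB: "B u \<bullet> v = u \<bullet> B v" for u v
    by (simp add: B_def blinfun.bilinear_simps inner_simps sym)
  define R where "R = id_blinfun - Y"
  have "(\<lambda>n. sqrt_iter B (Suc n)) \<longlonglongrightarrow> (1/2) *\<^sub>R (B + (Y o\<^sub>L Y))"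
    unfolding sqrt_iter.simps by (intro tendsto_intros Y)
  then have fixpoint: "Y = (1/2) *\<^sub>R (B + (Y o\<^sub>L Y))"
    using Y LIMSEQ_Suc LIMSEQ_unique by blast
  have "R (R u) = L u" for u
  proof -
    have "Y u = (1/2) *\<^sub>R (B u + Y (Y u))"
      by (subst fixpoint) (simp add: blinfun.bilinear_simps)
    then have "2 *\<^sub>R Y u = B u + Y (Y u)"
      by (metis scaleR_half_double scaleR_2 scaleR_scaleR scaleR_one nonzero_eq_divide_eq mult.commute zero_neq_numeral)
    then show ?thesis
      by (simp add: R_def B_def blinfun.bilinear_simps scaleR_2 algebra_simps)
  qed
  then have RR: "R o\<^sub>L R = L"
    by (intro blinfun_eqI) simp
  have "norm Y \<le> 1"
    using norm_sqrt_iter_le[OF \<open>norm B \<le> 1\<close>] sqrt_majorant_bounds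
    by (intro Lim_bounded[OF tendsto_norm[OF Y]]) (auto intro: order_trans)
  have Rsym: "R u \<bullet> v = u \<bullet> R v" for u v
  proof -
    have "(\<lambda>n. sqrt_iter B n u \<bullet> v) \<longlonglongrightarrow> Y u \<bullet> v" "(\<lambda>n. u \<bullet> sqrt_iter B n v) \<longlonglongrightarrow> u \<bullet> Y v"
      by (intro tendsto_intros Y)+
    then have "Y u \<bullet> v = u \<bullet> Y v"
      using LIMSEQ_unique by (simp add: sqrt_iter_selfadjoint[OF symB]) blast
    then show ?thesis
      by (simp add: R_def blinfun.bilinear_simps inner_simps)
  qed
  have Rpos: "0 \<le> R u \<bullet> u" for u
  proof -
    have "Y u \<bullet> u \<le> norm (Y u) * norm u"
      by (rule norm_cauchy_schwarz)
    also have "\<dots> \<le> (1 * norm u) * norm u"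
      using norm_blinfun[of Y u] mult_right_mono[OF \<open>norm Y \<le> 1\<close> norm_ge_zero[of u]]
      by (intro mult_right_mono) auto
    finally show ?thesis
      by (simp add: R_def blinfun.bilinear_simps inner_simps dot_square_norm power2_eq_square)
  qed
  have "R o\<^sub>L Q = Q o\<^sub>L R" if Q: "L o\<^sub>L Q = Q o\<^sub>L L" for Q
  proof -
    have "B o\<^sub>L Q = Q o\<^sub>L B"
      unfolding B_def using Q
      by (intro blinfun_eqI) (simp add: blinfun.bilinear_simps, metis blinfun_apply_blinfun_compose)
    then have *: "sqrt_iter B n o\<^sub>L Q = Q o\<^sub>L sqrt_iter B n" for n
      by (rule sqrt_iter_commute[OF \<open>norm B \<le> 1\<close>])
    have "(\<lambda>n. sqrt_iter B n o\<^sub>L Q) \<longlonglongrightarrow> (Y o\<^sub>L Q)"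
      "(\<lambda>n. Q o\<^sub>L sqrt_iter B n) \<longlonglongrightarrow> (Q o\<^sub>L Y)"
      by (intro tendsto_intros Y)+
    then have "Y o\<^sub>L Q = Q o\<^sub>L Y"
      unfolding * by (rule LIMSEQ_unique)
    moreover have "id_blinfun o\<^sub>L Q = Q o\<^sub>L id_blinfun"
      by (rule blinfun_eqI) simp
    ultimately show ?thesis
      by (simp add: R_def flip: blinfun_compose_left_diff blinfun_compose_right_diff)
  qed
  then show ?thesis
    using RR Rsym Rpos selfadjoint_nonneg_iff by blast
qed

lemma selfadjoint_nonneg_scaleR:
  fixes L :: "'a::{real_inner,banach} \<Rightarrow>\<^sub>L 'a"
  shows "selfadjoint_nonneg L \<Longrightarrow> 0 \<le> c \<Longrightarrow> selfadjoint_nonneg (c *\<^sub>R L)"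
  unfolding selfadjoint_nonneg_iff by (auto simp: blinfun.scaleR_left intro: mult_nonneg_nonneg)

lemma ex_sqrt:
  fixes L :: "'a::{real_inner,banach} \<Rightarrow>\<^sub>L 'a"
  assumes L: "selfadjoint_nonneg L"
  shows "\<exists>R. selfadjoint_nonneg R \<and> R o\<^sub>L R = L \<and> (\<forall>Q. L o\<^sub>L Q = Q o\<^sub>L L \<longrightarrow> R o\<^sub>L Q = Q o\<^sub>L R)"
proof -
  \<comment> \<open>Rescaling reduces to a contraction; the summand \<open>1\<close> keeps
    \<open>c\<close> positive when \<open>L = 0\<close>.\<close>
  define c where "c = norm L + 1"
  have "0 < c"
    using norm_ge_zero[of L] unfolding c_def by linarith
  have "norm (inverse c *\<^sub>R L) \<le> 1"
    using \<open>0 < c\<close> by (simp add: c_def divide_simps)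
  moreover have "selfadjoint_nonneg (inverse c *\<^sub>R L)"
    using L \<open>0 < c\<close> by (intro selfadjoint_nonneg_scaleR) auto
  ultimately obtain R where R: "selfadjoint_nonneg R" "R o\<^sub>L R = inverse c *\<^sub>R L"
    and comm: "\<And>Q. (inverse c *\<^sub>R L) o\<^sub>L Q = Q o\<^sub>L (inverse c *\<^sub>R L) \<Longrightarrow> R o\<^sub>L Q = Q o\<^sub>L R"
    using ex_sqrt_contraction by blast
  have "selfadjoint_nonneg (sqrt c *\<^sub>R R)"
    using R \<open>0 < c\<close> by (intro selfadjoint_nonneg_scaleR) auto
  moreover have "(sqrt c *\<^sub>R R) o\<^sub>L (sqrt c *\<^sub>R R) = L"
  proof (rule blinfun_eqI)
    fix u
    have "R (R u) = inverse c *\<^sub>R L u"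
      using R(2) by (metis blinfun_apply_blinfun_compose blinfun.scaleR_left)
    then show "((sqrt c *\<^sub>R R) o\<^sub>L (sqrt c *\<^sub>R R)) u = L u"
      using \<open>0 < c\<close> by (simp add: blinfun.bilinear_simps flip: mult.assoc)
  qed
  moreover have "(sqrt c *\<^sub>R R) o\<^sub>L Q = Q o\<^sub>L (sqrt c *\<^sub>R R)" if "L o\<^sub>L Q = Q o\<^sub>L L" for Q
    using that comm[of Q]
    by (simp add: bounded_bilinear.scaleR_left[OF bounded_bilinear_blinfun_compose]
        bounded_bilinear.scaleR_right[OF bounded_bilinear_blinfun_compose])
  ultimately show ?thesis
    by blast
qed

text \<open>Another root \<open>Q\<close> commutes with \<open>L = Q Q\<close>, hence with
  \<open>R\<close>. For \<open>v = Q u - R u\<close> this gives \<open>Q v + R v = 0\<close>, so the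
  non-negative numbers \<open>Q v \<bullet> v\<close> and \<open>R v \<bullet> v\<close> both
  vanish. Then \<open>Q v = R v = 0\<close>, and symmetry moves \<open>Q - R\<close> across
  \<open>v \<bullet> v\<close> to make it \<open>0\<close>.\<close>

lemma ex1_sqrt:
  fixes L :: "'a::{real_inner,banach} \<Rightarrow>\<^sub>L 'a"
  assumes L: "selfadjoint_nonneg L"
  shows "\<exists>!R. selfadjoint_nonneg R \<and> R o\<^sub>L R = L"
proof -
  obtain R where R: "selfadjoint_nonneg R" "R o\<^sub>L R = L"
    and comm: "\<And>Q. L o\<^sub>L Q = Q o\<^sub>L L \<Longrightarrow> R o\<^sub>L Q = Q o\<^sub>L R"
    using ex_sqrt[OF L] by blast
  have kernel: "P v = 0" if "selfadjoint_nonneg P" "P v \<bullet> v = 0" for P :: "'a \<Rightarrow>\<^sub>L 'a" and v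
    using norm_square_le_inner[OF that(1) order_refl, of v] that(2) by simp
  have "Q = R" if Q: "selfadjoint_nonneg Q" "Q o\<^sub>L Q = L" for Q
  proof (rule blinfun_eqI)
    fix u
    have RR: "R (R w) = L w" and QQ: "Q (Q w) = L w" for w
      using R Q by (metis blinfun_apply_blinfun_compose)+
    have "L o\<^sub>L Q = Q o\<^sub>L L"
      by (rule blinfun_eqI) (simp flip: QQ)
    then have RQ: "R (Q w) = Q (R w)" for w
      using comm by (metis blinfun_apply_blinfun_compose)
    define v where "v = Q u - R u"
    have "Q v + R v = 0"
      by (simp add: v_def blinfun.bilinear_simps RR QQ RQ)
    then have "Q v \<bullet> v + R v \<bullet> v = 0"
      by (simp flip: inner_add_left)
    moreover have "0 \<le> Q v \<bullet> v" "0 \<le> R v \<bullet> v"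
      using Q R by (auto simp: selfadjoint_nonneg_iff)
    ultimately have "Q v = 0" "R v = 0"
      using kernel Q R by (smt (verit))+
    have "v \<bullet> v = Q u \<bullet> v - R u \<bullet> v"
      by (simp add: v_def inner_diff_left)
    also have "\<dots> = u \<bullet> Q v - u \<bullet> R v"
      using Q R by (simp add: selfadjoint_nonneg_iff)
    finally show "Q u = R u"
      using \<open>Q v = 0\<close> \<open>R v = 0\<close> by (simp add: v_def)
  qed
  with R show ?thesis
    by blast
qed

lemma norm_op_sqrt_apply:
  fixes L :: "'a::{real_inner,banach} \<Rightarrow>\<^sub>L 'a"
  assumes L: "selfadjoint_nonneg L"
  shows "(norm (op_sqrt L u))\<^sup>2 = L u \<bullet> u"
proof -
  have R: "selfadjoint_nonneg (op_sqrt L) \<and> op_sqrt L o\<^sub>L op_sqrt L = L"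
    unfolding op_sqrt_def by (rule theI'[OF ex1_sqrt[OF L]])
  then have "op_sqrt L (op_sqrt L u) = L u"
    by (metis blinfun_apply_blinfun_compose)
  then show ?thesis
    using R by (metis power2_norm_eq_inner selfadjoint_nonneg_iff)
qed

section \<open>The operator exponential\<close>

lemma norm_compose_power_le:
  fixes L :: "'a::real_normed_vector \<Rightarrow>\<^sub>L 'a"
  assumes "norm L \<le> m"
  shows "norm (((\<lambda>R. L o\<^sub>L R) ^^ n) id_blinfun) \<le> m ^ n"
proof (induction n)
  case (Suc n)
  then show ?case
    using norm_blinfun_compose_le[OF assms Suc] by simp
qed (simp add: norm_blinfun_id_le)

text \<open>Exchanging one factor at a time, \<open>L P - L' P' = L (P - P') + (L - L') P'\<close>,
  costs \<open>m ^ n * norm (L - L')\<close> per factor. The zeroth powers agree, and starting at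
  \<open>Suc n\<close> keeps subtraction out of the exponent.\<close>

lemma norm_compose_power_diff_le:
  fixes L L' :: "'a::real_normed_vector \<Rightarrow>\<^sub>L 'a"
  assumes "norm L \<le> m" "norm L' \<le> m"
  shows "norm (((\<lambda>R. L o\<^sub>L R) ^^ Suc n) id_blinfun - ((\<lambda>R. L' o\<^sub>L R) ^^ Suc n) id_blinfun)
    \<le> real (Suc n) * m ^ n * norm (L - L')"
proof (induction n)
  case 0
  have "L o\<^sub>L id_blinfun = L" for L :: "'a \<Rightarrow>\<^sub>L 'a"
    by (rule blinfun_eqI) simp
  then show ?case by simp
next
  case (Suc n)
  let ?P = "((\<lambda>R. L o\<^sub>L R) ^^ Suc n) id_blinfun" and ?P' = "((\<lambda>R. L' o\<^sub>L R) ^^ Suc n) id_blinfun"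
  have "(L o\<^sub>L ?P) - (L' o\<^sub>L ?P') = (L o\<^sub>L (?P - ?P')) + ((L - L') o\<^sub>L ?P')"
    by (simp del: funpow.simps flip: blinfun_compose_left_diff blinfun_compose_right_diff)
  also have "norm \<dots> \<le> m * (real (Suc n) * m ^ n * norm (L - L')) + norm (L - L') * m ^ Suc n"
    by (intro norm_triangle_mono norm_blinfun_compose_le assms Suc.IH norm_compose_power_le order_refl)
  also have "\<dots> = real (Suc (Suc n)) * m ^ Suc n * norm (L - L')"
    by (simp add: algebra_simps)
  finally show ?case
    by (simp only: funpow.simps o_apply)
qed

lemma op_exp_summable:
  fixes L :: "'a::banach \<Rightarrow>\<^sub>L 'a"
  shows "summable (\<lambda>n. ((\<lambda>R. L o\<^sub>L R) ^^ n) id_blinfun /\<^sub>R fact n)"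
proof (rule summable_comparison_test'[of "\<lambda>n. norm L ^ n /\<^sub>R fact n" 0])
  show "norm (((\<lambda>R. L o\<^sub>L R) ^^ n) id_blinfun /\<^sub>R fact n) \<le> norm L ^ n /\<^sub>R fact n" for n
    using norm_compose_power_le[OF order_refl[of "norm L"], of n] by (simp add: divide_simps)
qed (rule summable_exp_generic)

lemma norm_op_exp_le:
  fixes L :: "'a::banach \<Rightarrow>\<^sub>L 'a"
  assumes "norm L \<le> m"
  shows "norm (op_exp L) \<le> exp m"
proof -
  have "norm (op_exp L) \<le> (\<Sum>n. m ^ n /\<^sub>R fact n)"
    unfolding op_exp_def
  proof (rule norm_suminf_le)
    show "norm (((\<lambda>R. L o\<^sub>L R) ^^ n) id_blinfun /\<^sub>R fact n) \<le> m ^ n /\<^sub>R fact n" for n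
      using norm_compose_power_le[OF assms, of n] by (simp add: divide_simps)
  qed (rule summable_exp_generic)
  then show ?thesis
    by (simp add: exp_def)
qed

text \<open>The identity terms of the two series cancel. In the shifted series the factor
  \<open>Suc n\<close> from the power estimate cancels against \<open>fact (Suc n)\<close>, so the
  scalar exponential series of \<open>m\<close> reappears.\<close>

lemma norm_op_exp_diff_le:
  fixes L L' :: "'a::banach \<Rightarrow>\<^sub>L 'a"
  assumes "norm L \<le> m" "norm L' \<le> m"
  shows "norm (op_exp L - op_exp L') \<le> exp m * norm (L - L')"
proof -
  let ?f = "\<lambda>L n. ((\<lambda>R. L o\<^sub>L R) ^^ n) id_blinfun /\<^sub>R fact n :: 'a \<Rightarrow>\<^sub>L 'a"
  have s: "summable (\<lambda>n. ?f L (Suc n))" for L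
    using op_exp_summable by (subst summable_Suc_iff)
  have "op_exp L - op_exp L' = (\<Sum>n. ?f L (Suc n)) - (\<Sum>n. ?f L' (Suc n))"
    unfolding op_exp_def using suminf_split_head[OF op_exp_summable[of L]]
      suminf_split_head[OF op_exp_summable[of L']] by simp
  also have "\<dots> = (\<Sum>n. ?f L (Suc n) - ?f L' (Suc n))"
    by (rule suminf_diff[OF s s])
  also have "norm \<dots> \<le> (\<Sum>n. (m ^ n /\<^sub>R fact n) * norm (L - L'))"
  proof (rule norm_suminf_le)
    fix n
    have "norm (?f L (Suc n) - ?f L' (Suc n)) \<le> real (Suc n) * m ^ n * norm (L - L') / fact (Suc n)"
      using norm_compose_power_diff_le[OF assms, of n]
      by (simp del: funpow.simps fact_Suc add: divide_right_mono divide_inverse_commute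
          flip: scaleR_diff_right)
    also have "\<dots> = (m ^ n /\<^sub>R fact n) * norm (L - L')"
      by (simp add: divide_simps)
    finally show "norm (?f L (Suc n) - ?f L' (Suc n)) \<le> (m ^ n /\<^sub>R fact n) * norm (L - L')" .
  qed (intro summable_mult2 summable_exp_generic)
  also have "\<dots> = exp m * norm (L - L')"
    unfolding exp_def by (rule suminf_mult2[symmetric]) (rule summable_exp_generic)
  finally show ?thesis .
qed

lemma norm_op_exp_scale_le:
  fixes L :: "'a::banach \<Rightarrow>\<^sub>L 'a"
  assumes "\<bar>t\<bar> \<le> T" "norm L \<le> l"
  shows "norm (op_exp (- (t *\<^sub>R L))) \<le> exp (T * l)"
  using assms by (intro norm_op_exp_le) (simp add: mult_mono)

lemma norm_op_exp_scale_diff_le: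
  fixes L L' :: "'a::banach \<Rightarrow>\<^sub>L 'a"
  assumes "\<bar>t\<bar> \<le> T" "norm L \<le> l" "norm L' \<le> l"
  shows "norm (op_exp (- (t *\<^sub>R L)) - op_exp (- (t *\<^sub>R L'))) \<le> exp (T * l) * (T * norm (L - L'))"
proof -
  have "norm (op_exp (- (t *\<^sub>R L)) - op_exp (- (t *\<^sub>R L')))
      \<le> exp (T * l) * norm (- (t *\<^sub>R L) - - (t *\<^sub>R L'))"
    using assms by (intro norm_op_exp_diff_le) (simp_all add: mult_mono)
  also have "- (t *\<^sub>R L) - - (t *\<^sub>R L') = - (t *\<^sub>R (L - L'))"
    by (simp add: scaleR_diff_right)
  also have "exp (T * l) * norm (- (t *\<^sub>R (L - L'))) \<le> exp (T * l) * (T * norm (L - L'))"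
    using assms by (simp add: mult_right_mono)
  finally show ?thesis .
qed

lemma norm_op_exp_time_diff_le:
  fixes L :: "'a::banach \<Rightarrow>\<^sub>L 'a"
  assumes "\<bar>s\<bar> \<le> T" "\<bar>t\<bar> \<le> T"
  shows "norm (op_exp (- (s *\<^sub>R L)) - op_exp (- (t *\<^sub>R L))) \<le> exp (T * norm L) * (\<bar>s - t\<bar> * norm L)"
proof -
  have "norm (op_exp (- (s *\<^sub>R L)) - op_exp (- (t *\<^sub>R L)))
      \<le> exp (T * norm L) * norm (- (s *\<^sub>R L) - - (t *\<^sub>R L))"
    using assms by (intro norm_op_exp_diff_le) (simp_all add: mult_right_mono)
  also have "- (s *\<^sub>R L) - - (t *\<^sub>R L) = - ((s - t) *\<^sub>R L)"
    by (simp add: scaleR_diff_left)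
  finally show ?thesis
    by simp
qed

lemma continuous_on_op_exp [continuous_intros]:
  fixes L :: "'a::banach \<Rightarrow>\<^sub>L 'a"
  assumes f: "continuous_on X f"
  shows "continuous_on X (\<lambda>t. op_exp (- (f t *\<^sub>R L)))"
proof -
  have "isCont (\<lambda>t. op_exp (- (t *\<^sub>R L))) t" for t
    unfolding isCont_def
  proof (rule LIM_zero_cancel, rule Lim_null_comparison)
    \<comment> \<open>The Lipschitz estimate needs one bound for both times; within distance
      \<open>1\<close> of \<open>t\<close> it is \<open>\<bar>t\<bar> + 1\<close>.\<close>
    show "((\<lambda>s. exp ((\<bar>t\<bar> + 1) * norm L) * (\<bar>s - t\<bar> * norm L)) \<longlongrightarrow> 0) (at t)"
      by (rule tendsto_eq_intros | simp)+
    show "\<forall>\<^sub>F s in at t. norm (op_exp (- (s *\<^sub>R L)) - op_exp (- (t *\<^sub>R L)))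
        \<le> exp ((\<bar>t\<bar> + 1) * norm L) * (\<bar>s - t\<bar> * norm L)"
      unfolding eventually_at
      by (intro exI[of _ 1]) (auto simp: dist_real_def intro!: norm_op_exp_time_diff_le)
  qed
  then show ?thesis
    using continuous_on_compose2[OF continuous_at_imp_continuous_on f, of UNIV] by auto
qed

section \<open>Integrals over compact intervals\<close>

lemma set_integrable_lebesgue_continuous:
  fixes f :: "real \<Rightarrow> 'a::{banach,second_countable_topology}"
  assumes "continuous_on {a..b} f"
  shows "set_integrable lebesgue {a..b} f"
  using borel_integrable_atLeastAtMost'[OF assms]
  unfolding set_integrable_def
  by (subst integrable_completion) (auto dest: borel_measurable_integrable)

lemma set_integral_norm_le:
  fixes f :: "real \<Rightarrow> 'a::{banach,second_countable_topology}"
  assumes f: "continuous_on {a..b} f" and g: "continuous_on {a..b} g"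
    and le: "\<And>s. s \<in> {a..b} \<Longrightarrow> norm (f s) \<le> g s"
  shows "norm (LINT s:{a..b}|lebesgue. f s) \<le> (LINT s:{a..b}|lebesgue. g s)"
proof -
  have "norm (LINT s:{a..b}|lebesgue. f s) \<le> (LINT s:{a..b}|lebesgue. norm (f s))"
    by (intro set_integral_norm_bound set_integrable_lebesgue_continuous f)
  also have "\<dots> \<le> (LINT s:{a..b}|lebesgue. g s)"
    by (intro set_integral_mono set_integrable_lebesgue_continuous continuous_on_norm f g le)
  finally show ?thesis .
qed

lemma set_integral_norm_le_const:
  fixes f :: "real \<Rightarrow> 'a::{banach,second_countable_topology}"
  assumes "continuous_on {a..b} f" "a \<le> b"
    and "\<And>s. s \<in> {a..b} \<Longrightarrow> norm (f s) \<le> c"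
  shows "norm (LINT s:{a..b}|lebesgue. f s) \<le> c * (b - a)"
  using set_integral_norm_le[of a b f "\<lambda>_. c"] assms
  by (simp add: set_lebesgue_integral_def mult.commute)

lemma set_integral_split:
  fixes f :: "real \<Rightarrow> 'a::{banach,second_countable_topology}"
  assumes "continuous_on {a..c} f" "a \<le> b" "b \<le> c"
  shows "(LINT s:{a..c}|lebesgue. f s)
    = (LINT s:{a..b}|lebesgue. f s) + (LINT s:{b..c}|lebesgue. f s)"
proof -
  have "{a..c} = {a..b} \<union> {b..c}"
    using assms by auto
  moreover have "AE s in lebesgue. \<not> (s \<in> {a..b} \<and> s \<in> {b..c})"
    by (rule AE_I'[of "{b}"]) auto
  ultimately show ?thesis
    using assms by (auto intro!: set_integral_Un_AE set_integrable_lebesgue_continuous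
        intro: continuous_on_subset)
qed

text \<open>Gronwall's inequality, obtained by maximising \<open>w s * exp (- l * s)\<close> for large \<open>l\<close>.\<close>

lemma gronwall:
  fixes w :: "real \<Rightarrow> real"
  assumes w: "continuous_on {0..T} w" and b: "0 \<le> b" and T: "0 \<le> T"
    and le: "\<And>t. t \<in> {0..T} \<Longrightarrow> w t \<le> a + b * (LINT s:{0..t}|lebesgue. w s)"
    and a: "0 \<le> a" and t: "t \<in> {0..T}"
  shows "w t \<le> 2 * a * exp ((2 * b + 1) * T)"
proof -
  \<comment> \<open>This choice makes \<open>b / l \<le> 1 / 2\<close>, so the integral term
    contributes at most \<open>N / 2\<close> and is absorbed on the left, whence the factor
    \<open>2\<close> in the bound. The summand \<open>1\<close> keeps \<open>l\<close> positive when
    \<open>b = 0\<close>.\<close>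
  define l where "l = 2 * b + 1"
  have "0 < l"
    using b by (simp add: l_def)
  have "continuous_on {0..T} (\<lambda>s. w s * exp (- l * s))"
    by (intro continuous_intros w)
  then obtain t0 where t0: "t0 \<in> {0..T}"
    and max: "\<And>s. s \<in> {0..T} \<Longrightarrow> w s * exp (- l * s) \<le> w t0 * exp (- l * t0)"
    using continuous_attains_sup[of "{0..T}" "\<lambda>s. w s * exp (- l * s)"] T by auto
  define N where "N = w t0 * exp (- l * t0)"
  have w_le: "w s \<le> N * exp (l * s)" if "s \<in> {0..T}" for s
  proof -
    have "w s = (w s * exp (- l * s)) * exp (l * s)"
      by (simp flip: exp_add)
    also have "\<dots> \<le> N * exp (l * s)"
      using max[OF that] by (intro mult_right_mono) (auto simp: N_def)
    finally show ?thesis .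
  qed
  have "N \<le> 2 * a"
  proof (cases "0 \<le> N")
    case True
    have int: "(LINT s:{0..t0}|lebesgue. N * exp (l * s)) = N * (exp (l * t0) - 1) / l"
    proof -
      have "((\<lambda>s. N * exp (l * s)) has_integral (N * exp (l * t0) / l - N * exp (l * 0) / l)) {0..t0}"
        using t0 \<open>0 < l\<close> by (intro fundamental_theorem_of_calculus)
          (auto intro!: derivative_eq_intros simp flip: has_real_derivative_iff_has_vector_derivative)
      moreover have "set_integrable lebesgue {0..t0} (\<lambda>s. N * exp (l * s))"
        by (intro set_integrable_lebesgue_continuous continuous_intros)
      ultimately show ?thesis
        using set_lebesgue_integral_eq_integral(2) integral_unique
        by (metis diff_divide_distrib exp_zero mult.right_neutral mult_zero_right right_diff_distrib)
    qed
    have "continuous_on {0..t0} w"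
      using w t0 by (auto intro: continuous_on_subset)
    then have "(LINT s:{0..t0}|lebesgue. w s) \<le> (LINT s:{0..t0}|lebesgue. N * exp (l * s))"
      using t0 by (intro set_integral_mono set_integrable_lebesgue_continuous continuous_intros w_le) auto
    also have "\<dots> \<le> N * exp (l * t0) / l"
      unfolding int using True \<open>0 < l\<close> by (intro divide_right_mono mult_left_mono) auto
    finally have "w t0 \<le> a + b * (N * exp (l * t0) / l)"
      using le[OF t0] mult_left_mono[OF _ b] by fastforce
    then have "N \<le> (a + b * (N * exp (l * t0) / l)) * exp (- l * t0)"
      unfolding N_def by (rule mult_right_mono) simp
    also have "\<dots> = a * exp (- l * t0) + b / l * N"
      by (simp add: distrib_right flip: exp_add)
    also have "\<dots> \<le> a + 1 / 2 * N"
    proof (intro add_mono mult_right_mono True)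
      show "a * exp (- l * t0) \<le> a"
        using a t0 \<open>0 < l\<close> by (intro mult_left_le) auto
      show "b / l \<le> 1 / 2"
        using b by (simp add: l_def field_simps)
    qed
    finally show ?thesis
      by simp
  qed (use a in simp)
  then have "N * exp (l * t) \<le> 2 * a * exp (l * T)"
    using t a \<open>0 < l\<close> by (intro mult_mono) auto
  then show ?thesis
    using w_le[OF t] by (simp add: l_def)
qed

section \<open>The memory state\<close>

lemma continuous_on_memory_integrand:
  fixes L :: "'u::banach \<Rightarrow>\<^sub>L 'u" and C :: "'r::real_normed_vector \<Rightarrow>\<^sub>L 'u"
  assumes "continuous_on {0..T} x" "X \<subseteq> {0..T}"
  shows "continuous_on X (\<lambda>s. op_exp (- ((t - s) *\<^sub>R L)) (C (x s)))"
  using continuous_on_subset[OF assms] by (intro continuous_intros)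

lemma norm_memory_integrand_le:
  fixes L :: "'u::banach \<Rightarrow>\<^sub>L 'u" and C :: "'r::real_normed_vector \<Rightarrow>\<^sub>L 'u"
  assumes "\<bar>t\<bar> \<le> T" "norm L \<le> l" "norm C \<le> c" "norm y \<le> X"
  shows "norm (op_exp (- (t *\<^sub>R L)) (C y)) \<le> exp (T * l) * (c * X)"
proof -
  have "0 \<le> c"
    using assms(3) norm_ge_zero[of C] by linarith
  have "norm (op_exp (- (t *\<^sub>R L)) (C y)) \<le> norm (op_exp (- (t *\<^sub>R L))) * (norm C * norm y)"
    by (meson norm_blinfun norm_ge_zero mult_left_mono order_trans)
  also have "\<dots> \<le> exp (T * l) * (c * X)"
    using assms \<open>0 \<le> c\<close> by (intro mult_mono norm_op_exp_scale_le) auto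
  finally show ?thesis .
qed

lemma norm_memory_state_le:
  fixes L :: "'u::{banach,second_countable_topology} \<Rightarrow>\<^sub>L 'u"
    and C :: "'r::real_normed_vector \<Rightarrow>\<^sub>L 'u"
  assumes x: "continuous_on {0..T} x" and X: "\<And>s. s \<in> {0..T} \<Longrightarrow> norm (x s) \<le> X"
    and t: "t \<in> {0..T}"
  shows "norm (memory_state L C x t) \<le> exp (T * norm L) * (norm C * X) * T"
proof -
  have "0 \<le> X"
    using X[OF t] norm_ge_zero[of "x t"] by linarith
  have "norm (memory_state L C x t) \<le> exp (T * norm L) * (norm C * X) * (t - 0)"
    unfolding memory_state_def using t
    by (intro set_integral_norm_le_const continuous_on_memory_integrand[OF x]
        norm_memory_integrand_le X) auto
  also have "\<dots> \<le> exp (T * norm L) * (norm C * X) * T"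
    using t \<open>0 \<le> X\<close> by (intro mult_left_mono) auto
  finally show ?thesis .
qed

text \<open>Time enters both as the upper limit and inside the exponential. Splitting the integral
  at \<open>s\<close> separates the two effects: on \<open>{0..s}\<close> only the exponential
  changes, and \<open>{s..t}\<close> has length \<open>t - s\<close>. The summands of
  \<open>K\<close> are the resulting Lipschitz constants.\<close>

lemma continuous_on_memory_state:
  fixes L :: "'u::{banach,second_countable_topology} \<Rightarrow>\<^sub>L 'u"
    and C :: "'r::real_normed_vector \<Rightarrow>\<^sub>L 'u"
  assumes x: "continuous_on {0..T} x" and T: "0 \<le> T"
  shows "continuous_on {0..T} (memory_state L C x)"
proof -
  have "bounded (x ` {0..T})"
    by (intro compact_imp_bounded compact_continuous_image x compact_Icc)
  then obtain X where X: "\<And>s. s \<in> {0..T} \<Longrightarrow> norm (x s) \<le> X"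
    unfolding bounded_iff by blast
  have "0 \<le> X"
    using X[of 0] T norm_ge_zero[of "x 0"] by (meson atLeastAtMost_iff order_refl order_trans)
  define K where "K = exp (T * norm L) * norm L * (norm C * X) * T + exp (T * norm L) * (norm C * X)"
  have "0 \<le> K"
    using \<open>0 \<le> X\<close> T by (simp add: K_def)
  have "K-lipschitz_on {0..T} (memory_state L C x)"
  proof (rule lipschitz_on_leI)
    fix s t
    assume st: "s \<in> {0..T}" "t \<in> {0..T}" "s \<le> t"
    let ?f = "\<lambda>t r. op_exp (- ((t - r) *\<^sub>R L)) (C (x r))"
    have "memory_state L C x t = (LINT r:{0..s}|lebesgue. ?f t r) + (LINT r:{s..t}|lebesgue. ?f t r)"
      unfolding memory_state_def using st
      by (intro set_integral_split continuous_on_memory_integrand[OF x]) auto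
    then have "memory_state L C x t - memory_state L C x s
        = (LINT r:{0..s}|lebesgue. ?f t r - ?f s r) + (LINT r:{s..t}|lebesgue. ?f t r)"
      unfolding memory_state_def using st
      by (subst set_integral_diff(2))
        (auto intro!: set_integrable_lebesgue_continuous continuous_on_memory_integrand[OF x])
    also have "norm \<dots> \<le> exp (T * norm L) * ((t - s) * norm L) * (norm C * X) * (s - 0)
        + exp (T * norm L) * (norm C * X) * (t - s)"
    proof (intro norm_triangle_mono set_integral_norm_le_const continuous_on_diff
        continuous_on_memory_integrand[OF x])
      fix r
      assume r: "r \<in> {0..s}"
      have "?f t r - ?f s r
          = (op_exp (- ((t - r) *\<^sub>R L)) - op_exp (- ((s - r) *\<^sub>R L))) (C (x r))"
        by (simp add: blinfun.diff_left)
      also have "norm \<dots> \<le> norm (op_exp (- ((t - r) *\<^sub>R L)) - op_exp (- ((s - r) *\<^sub>R L)))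
          * (norm C * norm (x r))"
        by (meson norm_blinfun norm_ge_zero mult_left_mono order_trans)
      also have "\<dots> \<le> exp (T * norm L) * (\<bar>(t - r) - (s - r)\<bar> * norm L) * (norm C * X)"
        using r st by (intro mult_mono norm_op_exp_time_diff_le X) auto
      also have "\<bar>(t - r) - (s - r)\<bar> = t - s"
        using st by simp
      finally show "norm (?f t r - ?f s r) \<le> exp (T * norm L) * ((t - s) * norm L) * (norm C * X)" .
    next
      show "norm (?f t r) \<le> exp (T * norm L) * (norm C * X)" if "r \<in> {s..t}" for r
        using that st by (intro norm_memory_integrand_le X) auto
    qed (use st in auto)
    also have "\<dots> \<le> exp (T * norm L) * ((t - s) * norm L) * (norm C * X) * T
        + exp (T * norm L) * (norm C * X) * (t - s)"
      using st \<open>0 \<le> X\<close> by (intro add_right_mono mult_left_mono) auto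
    also have "\<dots> = K * (t - s)"
      by (simp add: K_def algebra_simps)
    finally show "dist (memory_state L C x s) (memory_state L C x t) \<le> K * dist s t"
      using st by (simp add: dist_norm norm_minus_commute dist_real_def)
  qed (rule \<open>0 \<le> K\<close>)
  then show ?thesis
    by (rule lipschitz_on_continuous_on)
qed

text \<open>The bounded operator \<open>adjoint C\<close> is constant in the integration variable
  and passes through the Bochner integral.\<close>

lemma convolution_memory_kernel:
  fixes L :: "'u::{real_inner,banach,second_countable_topology} \<Rightarrow>\<^sub>L 'u"
    and C :: "'r::{real_inner,banach,second_countable_topology} \<Rightarrow>\<^sub>L 'u"
  assumes x: "continuous_on {0..T} x" and t: "t \<in> {0..T}"
  shows "convolution (memory_kernel L C) x t = blinfun_adjoint C (memory_state L C x t)"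
proof -
  interpret bounded_linear "adjoint C"
    by (rule bounded_linear_adjoint)
  have "set_integrable lebesgue {0..t} (\<lambda>s. op_exp (- ((t - s) *\<^sub>R L)) (C (x s)))"
    using t by (intro set_integrable_lebesgue_continuous continuous_on_memory_integrand[OF x]) auto
  then show ?thesis
    unfolding convolution_def memory_kernel_def memory_state_def set_lebesgue_integral_def
      set_integrable_def
    by (simp add: integral_bounded_linear[OF bounded_linear_axioms, symmetric] scaleR)
qed

lemma norm_memory_state_diff_le:
  fixes L L' :: "'u::{real_inner,banach,second_countable_topology} \<Rightarrow>\<^sub>L 'u"
    and C C' :: "'r::real_normed_vector \<Rightarrow>\<^sub>L 'u"
  assumes x: "continuous_on {0..T} x" and x': "continuous_on {0..T} x'"
    and X: "\<And>s. s \<in> {0..T} \<Longrightarrow> norm (x s) \<le> X"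
    and L: "norm L \<le> l" "norm L' \<le> l" and C: "norm C \<le> c" "norm C' \<le> c"
    and t: "t \<in> {0..T}"
  defines "d \<equiv> exp (T * l) * X * (norm (C' - C) + T * c * norm (L' - L))"
  shows "norm (memory_state L' C' x' t - memory_state L C x t)
    \<le> exp (T * l) * c * (LINT s:{0..t}|lebesgue. norm (x' s - x s)) + d * T"
proof -
  let ?E = "\<lambda>L s. op_exp (- ((t - s) *\<^sub>R L))"
  have "0 \<le> X"
    using X[OF t] norm_ge_zero[of "x t"] by linarith
  have "0 \<le> c"
    using C(1) norm_ge_zero[of C] by linarith
  have "0 \<le> d"
    using \<open>0 \<le> X\<close> \<open>0 \<le> c\<close> t by (simp add: d_def)
  have sub: "{0..t} \<subseteq> {0..T}"
    using t by auto
  note cont = continuous_on_subset[OF x sub] continuous_on_subset[OF x' sub]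
  have w: "continuous_on {0..t} (\<lambda>s. norm (x' s - x s))"
    by (intro continuous_intros cont)
  have le: "norm (?E L' s (C' (x' s)) - ?E L s (C (x s))) \<le> exp (T * l) * c * norm (x' s - x s) + d"
    if s: "s \<in> {0..t}" for s
  proof -
    have s': "s \<in> {0..T}" and ts: "\<bar>t - s\<bar> \<le> T"
      using s t by auto
    \<comment> \<open>The primed operators act on \<open>x' s - x s\<close> and the operator errors
      act on \<open>x s\<close>. Hence the bound \<open>X\<close> for \<open>x\<close> suffices, and
      the two error terms add up to \<open>d\<close>.\<close>
    have "?E L' s (C' (x' s)) - ?E L s (C (x s)) = ?E L' s (C' (x' s - x s))
        + (?E L' s ((C' - C) (x s)) + (?E L' s - ?E L s) (C (x s)))"
      by (simp add: blinfun.bilinear_simps)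
    also have "norm \<dots> \<le> exp (T * l) * (c * norm (x' s - x s))
        + (exp (T * l) * (norm (C' - C) * X) + exp (T * l) * (T * norm (L' - L)) * (c * X))"
    proof (intro norm_triangle_mono norm_memory_integrand_le ts L C X s' order_refl)
      have "norm ((?E L' s - ?E L s) (C (x s))) \<le> norm (?E L' s - ?E L s) * (norm C * norm (x s))"
        by (meson norm_blinfun norm_ge_zero mult_left_mono order_trans)
      also have "\<dots> \<le> exp (T * l) * (T * norm (L' - L)) * (c * X)"
        using \<open>0 \<le> c\<close> t by (intro mult_mono norm_op_exp_scale_diff_le ts L C X s') auto
      finally show "norm ((?E L' s - ?E L s) (C (x s))) \<le> exp (T * l) * (T * norm (L' - L)) * (c * X)" .
    qed
    also have "\<dots> = exp (T * l) * c * norm (x' s - x s) + d"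
      by (simp add: d_def algebra_simps)
    finally show ?thesis .
  qed
  have "memory_state L' C' x' t - memory_state L C x t
      = (LINT s:{0..t}|lebesgue. ?E L' s (C' (x' s)) - ?E L s (C (x s)))"
    unfolding memory_state_def using sub
    by (subst set_integral_diff(2)) (auto intro!: set_integrable_lebesgue_continuous
        continuous_on_memory_integrand[OF x] continuous_on_memory_integrand[OF x'])
  also have "norm \<dots> \<le> (LINT s:{0..t}|lebesgue. exp (T * l) * c * norm (x' s - x s) + d)"
    using sub by (intro set_integral_norm_le continuous_on_diff continuous_on_memory_integrand[OF x]
        continuous_on_memory_integrand[OF x'] continuous_intros w le)
  also have "\<dots> = exp (T * l) * c * (LINT s:{0..t}|lebesgue. norm (x' s - x s)) + d * t"
  proof -
    have "set_integrable lebesgue {0..t} (\<lambda>s. exp (T * l) * c * norm (x' s - x s))"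
      "set_integrable lebesgue {0..t} (\<lambda>s. d)"
      by (intro set_integrable_lebesgue_continuous continuous_intros w)+
    moreover have "(LINT s:{0..t}|lebesgue. d) = d * t"
      using t by (simp add: set_lebesgue_integral_def)
    ultimately show ?thesis
      by (simp add: set_integral_add)
  qed
  also have "\<dots> \<le> exp (T * l) * c * (LINT s:{0..t}|lebesgue. norm (x' s - x s)) + d * T"
    using t \<open>0 \<le> d\<close> by (intro add_left_mono mult_left_mono) auto
  finally show ?thesis .
qed

section \<open>Stability of mild solutions\<close>

text \<open>Continuity of \<open>S\<close> is only strong, so the moving vector is frozen:
  \<open>S (t - r) (g r - g s)\<close> tends to \<open>0\<close> by the uniform bound
  \<open>P\<close>, and \<open>S (t - r) (g s)\<close> converges by strong continuity.\<close>

lemma continuous_on_semigroup_apply: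
  fixes S :: "real \<Rightarrow> ('a::real_normed_vector \<Rightarrow>\<^sub>L 'a)"
  assumes S: "C0_semigroup S" and P: "\<And>s. s \<in> {0..t} \<Longrightarrow> norm (S s) \<le> P"
    and g: "continuous_on {0..t} g"
  shows "continuous_on {0..t} (\<lambda>s. S (t - s) (g s))"
  unfolding continuous_on_def
proof
  fix s
  assume s: "s \<in> {0..t}"
  let ?F = "at s within {0..t}"
  have "continuous_on {0..t} (\<lambda>r. S (t - r) (g s))"
  proof (rule continuous_on_compose2[where f = "\<lambda>r. t - r"])
    show "continuous_on {0..} (\<lambda>r. S r (g s))"
      using S unfolding C0_semigroup_def by blast
  qed (auto intro: continuous_intros)
  then have 1: "((\<lambda>r. S (t - r) (g s)) \<longlongrightarrow> S (t - s) (g s)) ?F"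
    using s unfolding continuous_on_def by blast
  have "((\<lambda>r. S (t - r) (g r - g s)) \<longlongrightarrow> 0) ?F"
  proof (rule Lim_null_comparison)
    have "(g \<longlongrightarrow> g s) ?F"
      using g s unfolding continuous_on_def by blast
    then show "((\<lambda>r. P * norm (g r - g s)) \<longlongrightarrow> 0) ?F"
      by (auto intro!: tendsto_eq_intros)
    have "norm (S (t - r) (g r - g s)) \<le> P * norm (g r - g s)" if "r \<in> {0..t}" for r
      using that P[of "t - r"] by (intro order_trans[OF norm_blinfun] mult_right_mono) auto
    then show "\<forall>\<^sub>F r in ?F. norm (S (t - r) (g r - g s)) \<le> P * norm (g r - g s)"
      by (auto simp: eventually_at_filter)
  qed
  from tendsto_add[OF this 1] show "((\<lambda>r. S (t - r) (g r)) \<longlongrightarrow> S (t - s) (g s)) ?F"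
    by (simp add: blinfun.diff_right)
qed

text \<open>The forcing cancels even if \<open>s \<mapsto> S (t - s) (F s)\<close> is not integrable: both integrals are then \<open>0\<close>.\<close>

lemma norm_duhamel_diff_le:
  fixes S :: "real \<Rightarrow> ('a::{banach,second_countable_topology} \<Rightarrow>\<^sub>L 'a)"
  assumes S: "C0_semigroup S" and P: "\<And>s. s \<in> {0..t} \<Longrightarrow> norm (S s) \<le> P"
    and g: "continuous_on {0..t} g" and g': "continuous_on {0..t} g'"
    and t: "0 \<le> t" and e: "\<And>s. s \<in> {0..t} \<Longrightarrow> norm (g' s - g s) \<le> e"
  shows "norm ((LINT s:{0..t}|lebesgue. S (t - s) (F s - g' s))
    - (LINT s:{0..t}|lebesgue. S (t - s) (F s - g s))) \<le> P * e * t"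
proof -
  let ?I = "set_integrable lebesgue {0..t}"
  have cont: "continuous_on {0..t} (\<lambda>s. S (t - s) (h s))" if "continuous_on {0..t} h" for h
    by (rule continuous_on_semigroup_apply[OF S P that])
  have int: "?I (\<lambda>s. S (t - s) (h s))" if "continuous_on {0..t} h" for h
    by (intro set_integrable_lebesgue_continuous cont that)
  \<comment> \<open>Subtracting an integrable term does not affect integrability, so
    \<open>g\<close> and \<open>g'\<close> always fall into the same case below.\<close>
  have iff: "?I (\<lambda>s. S (t - s) (F s - h s)) \<longleftrightarrow> ?I (\<lambda>s. S (t - s) (F s))"
    if h: "continuous_on {0..t} h" for h
  proof
    show "?I (\<lambda>s. S (t - s) (F s))" if "?I (\<lambda>s. S (t - s) (F s - h s))"
      using set_integral_add(1)[OF that int[OF h]] by (simp add: blinfun.diff_right)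
    show "?I (\<lambda>s. S (t - s) (F s - h s))" if "?I (\<lambda>s. S (t - s) (F s))"
      using set_integral_diff(1)[OF that int[OF h]] by (simp add: blinfun.diff_right)
  qed
  have "0 \<le> P"
    using P[of 0] t norm_ge_zero[of "S 0"] by (meson atLeastAtMost_iff order_refl order_trans)
  have "0 \<le> e"
    using e[of 0] t norm_ge_zero[of "g' 0 - g 0"] by (meson atLeastAtMost_iff order_refl order_trans)
  show ?thesis
  proof (cases "?I (\<lambda>s. S (t - s) (F s))")
    case True
    have "(LINT s:{0..t}|lebesgue. S (t - s) (F s - g' s)) - (LINT s:{0..t}|lebesgue. S (t - s) (F s - g s))
        = (LINT s:{0..t}|lebesgue. S (t - s) (F s - g' s) - S (t - s) (F s - g s))"
      using True iff g g' by (subst set_integral_diff(2)) auto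
    also have "\<dots> = (LINT s:{0..t}|lebesgue. S (t - s) (g s - g' s))"
      by (simp add: blinfun.diff_right)
    also have "norm \<dots> \<le> P * e * (t - 0)"
    proof (intro set_integral_norm_le_const cont continuous_on_diff g g' t)
      fix s
      assume s: "s \<in> {0..t}"
      have "norm (S (t - s) (g s - g' s)) \<le> norm (S (t - s)) * norm (g s - g' s)"
        by (rule norm_blinfun)
      also have "\<dots> \<le> P * e"
        using s e[OF s] P[of "t - s"] \<open>0 \<le> P\<close>
        by (intro mult_mono) (auto simp: norm_minus_commute)
      finally show "norm (S (t - s) (g s - g' s)) \<le> P * e" .
    qed
    finally show ?thesis by simp
  next
    case False
    then have "(LINT s:{0..t}|lebesgue. S (t - s) (F s - h s)) = 0" if "continuous_on {0..t} h" for h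
      using iff[OF that] unfolding set_integrable_def set_lebesgue_integral_def
      by (simp add: not_integrable_integral_eq)
    with g g' show ?thesis
      using t \<open>0 \<le> P\<close> \<open>0 \<le> e\<close> by simp
  qed
qed

text \<open>Each summand of \<open>a\<close> carries a factor \<open>norm (C' - C)\<close> or
  \<open>norm (L' - L)\<close>. The feedback gain \<open>b\<close> consists of \<open>P\<close> from
  the semigroup, \<open>c\<close> from the adjoint, \<open>exp (T * l) * c\<close> from the memory
  state and \<open>T\<close> from the outer time integral.\<close>

lemma norm_mild_solution_diff_le:
  fixes L L' :: "'u::{real_inner,banach,second_countable_topology} \<Rightarrow>\<^sub>L 'u"
    and C C' :: "'r::{real_inner,banach,second_countable_topology} \<Rightarrow>\<^sub>L 'u"
  assumes S: "C0_semigroup S" and P: "\<And>s. s \<in> {0..T} \<Longrightarrow> norm (S s) \<le> P"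
    and x: "mild_solution S (memory_kernel L C) F x0 T x"
    and x': "mild_solution S (memory_kernel L' C') F x0 T x'"
    and X: "\<And>s. s \<in> {0..T} \<Longrightarrow> norm (x s) \<le> X"
    and Q: "\<And>s. s \<in> {0..T} \<Longrightarrow> norm (memory_state L C x s) \<le> Q"
    and L: "norm L \<le> l" "norm L' \<le> l" and C: "norm C \<le> c" "norm C' \<le> c"
    and t: "t \<in> {0..T}"
  defines "d \<equiv> exp (T * l) * X * (norm (C' - C) + T * c * norm (L' - L))"
  defines "a \<equiv> P * (c * (d * T) + norm (C' - C) * Q) * T"
    and "b \<equiv> P * (c * (exp (T * l) * c)) * T"
  shows "norm (x' t - x t) \<le> 2 * a * exp ((2 * b + 1) * T)"
proof -
  have cx: "continuous_on {0..T} x" and cx': "continuous_on {0..T} x'"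
    using x x' unfolding mild_solution_def by auto
  have "0 \<le> T"
    using t by auto
  have "0 \<le> X" "0 \<le> Q" "0 \<le> P"
    using X[OF t] Q[OF t] P[OF t] norm_ge_zero order_trans by blast+
  have "0 \<le> c"
    using C(1) norm_ge_zero order_trans by blast
  have "0 \<le> d"
    using \<open>0 \<le> X\<close> \<open>0 \<le> c\<close> \<open>0 \<le> T\<close> by (simp add: d_def)
  have "0 \<le> a" "0 \<le> b"
    using \<open>0 \<le> d\<close> \<open>0 \<le> c\<close> \<open>0 \<le> T\<close> \<open>0 \<le> Q\<close> \<open>0 \<le> P\<close> by (simp_all add: a_def b_def)
  let ?w = "\<lambda>s. norm (x' s - x s)"
  let ?q = "memory_state L C x" and ?q' = "memory_state L' C' x'"
  have cw: "continuous_on {0..T} ?w"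
    by (intro continuous_intros cx cx')
  have "?w r \<le> a + b * (LINT s:{0..r}|lebesgue. ?w s)" if r: "r \<in> {0..T}" for r
  proof -
    define W where "W = (LINT s:{0..r}|lebesgue. ?w s)"
    have sub: "{0..r} \<subseteq> {0..T}"
      using r by auto
    let ?g = "convolution (memory_kernel L C) x" and ?g' = "convolution (memory_kernel L' C') x'"
    have g: "?g s = blinfun_adjoint C (?q s)" and g': "?g' s = blinfun_adjoint C' (?q' s)"
      if "s \<in> {0..T}" for s
      using convolution_memory_kernel[OF cx that] convolution_memory_kernel[OF cx' that] by auto
    have cg: "continuous_on {0..T} ?g" "continuous_on {0..T} ?g'"
      by (subst continuous_on_cong[OF refl g], assumption,
          intro continuous_intros continuous_on_memory_state cx \<open>0 \<le> T\<close>)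
        (subst continuous_on_cong[OF refl g'], assumption,
          intro continuous_intros continuous_on_memory_state cx' \<open>0 \<le> T\<close>)
    have qd: "norm (?q' s - ?q s) \<le> exp (T * l) * c * W + d * T" if s: "s \<in> {0..r}" for s
    proof -
      have "norm (?q' s - ?q s) \<le> exp (T * l) * c * (LINT s:{0..s}|lebesgue. ?w s) + d * T"
        unfolding d_def using s sub
        by (intro norm_memory_state_diff_le cx cx' X L C) auto
      \<comment> \<open>The integrand is non-negative, so one number \<open>W\<close> dominates the
        inner integrals for all \<open>s\<close> up to \<open>r\<close>; the outer integration then
        costs only a factor at most \<open>T\<close>.\<close>
      also have "(LINT s:{0..s}|lebesgue. ?w s) \<le> W"
      proof -
        have "W = (LINT s:{0..s}|lebesgue. ?w s) + (LINT s:{s..r}|lebesgue. ?w s)"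
          unfolding W_def using s continuous_on_subset[OF cw sub] by (intro set_integral_split) auto
        moreover have "0 \<le> (LINT s:{s..r}|lebesgue. ?w s)"
          unfolding set_lebesgue_integral_def by (intro integral_nonneg_AE) simp
        ultimately show ?thesis by simp
      qed
      finally show ?thesis
        using \<open>0 \<le> c\<close> by (simp add: mult_left_mono)
    qed
    have gd: "norm (?g' s - ?g s) \<le> c * (exp (T * l) * c * W + d * T) + norm (C' - C) * Q"
      if s: "s \<in> {0..r}" for s
    proof -
      have s': "s \<in> {0..T}"
        using s sub by auto
      have "?g' s - ?g s = blinfun_adjoint C' (?q' s - ?q s) + blinfun_adjoint (C' - C) (?q s)"
        unfolding g[OF s'] g'[OF s'] blinfun_adjoint_diff by (simp only: blinfun.bilinear_simps) simp
      also have "norm \<dots> \<le> norm C' * norm (?q' s - ?q s) + norm (C' - C) * norm (?q s)"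
        by (intro norm_triangle_mono) (simp_all add: norm_adjoint_le)
      also have "\<dots> \<le> c * (exp (T * l) * c * W + d * T) + norm (C' - C) * Q"
        using \<open>0 \<le> c\<close> by (intro add_mono mult_mono C Q s' qd s) auto
      finally show ?thesis .
    qed
    have "x' r - x r = (LINT s:{0..r}|lebesgue. S (r - s) (F s - ?g' s))
        - (LINT s:{0..r}|lebesgue. S (r - s) (F s - ?g s))"
      using x x' r unfolding mild_solution_def by simp
    then have "?w r \<le> P * (c * (exp (T * l) * c * W + d * T) + norm (C' - C) * Q) * r"
      using norm_duhamel_diff_le[OF S, of r P ?g ?g'] P gd sub r
        continuous_on_subset[OF cg(1) sub] continuous_on_subset[OF cg(2) sub]
      by auto
    also have "\<dots> \<le> P * (c * (exp (T * l) * c * W + d * T) + norm (C' - C) * Q) * T"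
    proof (rule mult_left_mono)
      have "0 \<le> W"
        unfolding W_def set_lebesgue_integral_def by (intro integral_nonneg_AE) simp
      then show "0 \<le> P * (c * (exp (T * l) * c * W + d * T) + norm (C' - C) * Q)"
        using \<open>0 \<le> P\<close> \<open>0 \<le> c\<close> \<open>0 \<le> d\<close> \<open>0 \<le> T\<close> \<open>0 \<le> Q\<close> by simp
    qed (use r in auto)
    also have "\<dots> = a + b * W"
      by (simp add: a_def b_def algebra_simps)
    finally show ?thesis
      unfolding W_def .
  qed
  then show ?thesis
    by (rule gronwall[OF cw \<open>0 \<le> b\<close> \<open>0 \<le> T\<close> _ \<open>0 \<le> a\<close> t])
qed

section \<open>Convergence\<close>

lemma uniform_limit_norm_bound:
  fixes f :: "'i \<Rightarrow> 'b \<Rightarrow> 'a::real_normed_vector"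
  assumes "\<forall>\<^sub>F n in F. \<forall>t\<in>X. norm (f n t - g t) \<le> e n" and "(e \<longlongrightarrow> 0) F"
  shows "uniform_limit X f g F"
proof (rule uniform_limitI)
  fix \<epsilon> :: real
  assume "0 < \<epsilon>"
  with assms(2) have "\<forall>\<^sub>F n in F. e n < \<epsilon>"
    by (rule order_tendstoD)
  with assms(1) show "\<forall>\<^sub>F n in F. \<forall>t\<in>X. dist (f n t) (g t) < \<epsilon>"
    by eventually_elim (auto simp: dist_norm intro: le_less_trans)
qed

lemma tendsto_set_integral_uniform_limit:
  fixes f :: "nat \<Rightarrow> real \<Rightarrow> 'a::{banach,second_countable_topology}"
  assumes f: "\<And>n. continuous_on {a..b} (f n)" and g: "continuous_on {a..b} g"
    and lim: "uniform_limit {a..b} f g sequentially" and ab: "a \<le> b"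
  shows "(\<lambda>n. LINT s:{a..b}|lebesgue. f n s) \<longlonglongrightarrow> (LINT s:{a..b}|lebesgue. g s)"
proof (rule LIMSEQ_I)
  fix \<epsilon> :: real
  assume "0 < \<epsilon>"
  \<comment> \<open>The summand \<open>1\<close> avoids division by zero when
    \<open>a = b\<close>.\<close>
  define \<delta> where "\<delta> = \<epsilon> / (b - a + 1)"
  have "0 < \<delta>"
    using \<open>0 < \<epsilon>\<close> ab by (simp add: \<delta>_def)
  then obtain N where N: "\<And>n s. n \<ge> N \<Longrightarrow> s \<in> {a..b} \<Longrightarrow> norm (f n s - g s) < \<delta>"
    using uniform_limitD[OF lim] unfolding eventually_sequentially dist_norm by blast
  have "norm ((LINT s:{a..b}|lebesgue. f n s) - (LINT s:{a..b}|lebesgue. g s)) < \<epsilon>" if "n \<ge> N" for n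
  proof -
    have "(LINT s:{a..b}|lebesgue. f n s) - (LINT s:{a..b}|lebesgue. g s)
        = (LINT s:{a..b}|lebesgue. f n s - g s)"
      by (subst set_integral_diff(2)) (auto intro: set_integrable_lebesgue_continuous f g)
    also have "norm \<dots> \<le> \<delta> * (b - a)"
      using N[OF that] by (intro set_integral_norm_le_const continuous_on_diff f g ab) (auto intro: less_imp_le)
    also have "\<dots> < \<delta> * (b - a + 1)"
      using \<open>0 < \<delta>\<close> by simp
    also have "\<dots> = \<epsilon>"
      using ab by (simp add: \<delta>_def)
    finally show ?thesis .
  qed
  then show "\<exists>N. \<forall>n\<ge>N. norm ((LINT s:{a..b}|lebesgue. f n s) - (LINT s:{a..b}|lebesgue. g s)) < \<epsilon>"
    by blast
qed

lemma storage_dissipation_tendsto: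
  fixes Ls :: "nat \<Rightarrow> ('u::{real_inner,banach,second_countable_topology} \<Rightarrow>\<^sub>L 'u)"
  assumes Ls: "\<And>n. selfadjoint_nonneg (Ls n)" and L: "selfadjoint_nonneg L"
    and lim: "Ls \<longlonglongrightarrow> L" and q: "converges_in_C T qs q" and T: "0 \<le> T"
  shows "(\<lambda>n. storage_dissipation (Ls n) T (qs n)) \<longlonglongrightarrow> storage_dissipation L T q"
proof -
  have cq: "\<And>n. continuous_on {0..T} (qs n)" "continuous_on {0..T} q"
    and uq: "uniform_limit {0..T} qs q sequentially"
    using q unfolding converges_in_C_def by auto
  have bq: "bounded (q ` {0..T})" "bounded ((\<lambda>t. L (q t)) ` {0..T})"
    by (intro compact_imp_bounded compact_continuous_image continuous_intros cq compact_Icc)+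
  \<comment> \<open>Read as operator-valued functions constant in time, the \<open>Ls n\<close> fit
    the uniform-limit rule for bounded bilinear maps. It serves for evaluation and for the inner
    product, and asks for boundedness of the limits only.\<close>
  have uL: "uniform_limit {0..T} (\<lambda>n t. Ls n) (\<lambda>t. L) sequentially"
    using lim by (intro uniform_limit_norm_bound[of _ _ _ "\<lambda>n. norm (Ls n - L)"])
      (auto intro: tendsto_norm_zero LIM_zero)
  have "uniform_limit {0..T} (\<lambda>n t. Ls n (qs n t)) (\<lambda>t. L (q t)) sequentially"
    by (rule bounded_bilinear.bounded_uniform_limit[OF bounded_bilinear_blinfun_apply uL uq])
      (auto intro: bq bounded_subset[of "{L}"])
  then have "uniform_limit {0..T} (\<lambda>n t. Ls n (qs n t) \<bullet> qs n t) (\<lambda>t. L (q t) \<bullet> q t) sequentially"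
    by (rule bounded_bilinear.bounded_uniform_limit[OF bounded_bilinear_inner _ uq])
      (use bq in auto)
  then have "(\<lambda>n. LINT t:{0..T}|lebesgue. Ls n (qs n t) \<bullet> qs n t)
      \<longlonglongrightarrow> (LINT t:{0..T}|lebesgue. L (q t) \<bullet> q t)"
    by (intro tendsto_set_integral_uniform_limit continuous_intros cq T)
  moreover have "(\<lambda>n. qs n T) \<longlonglongrightarrow> q T"
    using tendsto_uniform_limitI[OF uq] T by simp
  ultimately show ?thesis
    unfolding storage_dissipation_def norm_op_sqrt_apply[OF Ls] norm_op_sqrt_apply[OF L]
    by (intro tendsto_intros)
qed

lemma mild_solutions_converge:
  fixes Ls :: "nat \<Rightarrow> ('u::{real_inner,banach,second_countable_topology} \<Rightarrow>\<^sub>L 'u)"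
    and Cs :: "nat \<Rightarrow> ('r::{real_inner,banach,second_countable_topology} \<Rightarrow>\<^sub>L 'u)"
  assumes S: "C0_semigroup S" and P: "\<And>s. s \<in> {0..T} \<Longrightarrow> norm (S s) \<le> P" and T: "0 \<le> T"
    and Ls: "Ls \<longlonglongrightarrow> L" and Cs: "Cs \<longlonglongrightarrow> C"
    and xs: "\<And>n. mild_solution S (memory_kernel (Ls n) (Cs n)) F x0 T (xs n)"
    and x: "mild_solution S (memory_kernel L C) F x0 T x"
  shows "converges_in_C T xs x"
    and "converges_in_C T (\<lambda>n. memory_state (Ls n) (Cs n) (xs n)) (memory_state L C x)"
proof -
  have cx: "continuous_on {0..T} x" and cxs: "\<And>n. continuous_on {0..T} (xs n)"
    using x xs unfolding mild_solution_def by auto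
  have "bounded (x ` {0..T})"
    by (intro compact_imp_bounded compact_continuous_image cx compact_Icc)
  then obtain X where X: "\<And>s. s \<in> {0..T} \<Longrightarrow> norm (x s) \<le> X"
    unfolding bounded_iff by blast
  define Q where "Q = exp (T * norm L) * (norm C * X) * T"
  have Q: "\<And>s. s \<in> {0..T} \<Longrightarrow> norm (memory_state L C x s) \<le> Q"
    unfolding Q_def by (rule norm_memory_state_le[OF cx X])
  \<comment> \<open>The margin above the limit norms makes both bounds hold eventually, so the
    estimates below have constants independent of \<open>n\<close> and are valid for large
    \<open>n\<close>.\<close>
  define l c where "l = norm L + 1" and "c = norm C + 1"
  have "0 \<le> c"
    by (simp add: c_def)
  define d where "d n = exp (T * l) * X * (norm (Cs n - C) + T * c * norm (Ls n - L))" for n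
  define a where "a n = P * (c * (d n * T) + norm (Cs n - C) * Q) * T" for n
  define b where "b = P * (c * (exp (T * l) * c)) * T"
  define e where "e n = 2 * a n * exp ((2 * b + 1) * T)" for n
  have "(\<lambda>n. norm (Cs n - C)) \<longlonglongrightarrow> 0" "(\<lambda>n. norm (Ls n - L)) \<longlonglongrightarrow> 0"
    using Ls Cs by (auto intro: tendsto_norm_zero LIM_zero)
  note null = tendsto_mult_right_zero tendsto_mult_left_zero tendsto_add_zero this
  have d0: "d \<longlonglongrightarrow> 0"
    unfolding d_def by (intro null)
  have e0: "e \<longlonglongrightarrow> 0"
    unfolding e_def a_def by (intro null d0)
  have "\<forall>\<^sub>F n in sequentially. norm (Ls n) < l" "\<forall>\<^sub>F n in sequentially. norm (Cs n) < c"
    using tendsto_norm[OF Ls] tendsto_norm[OF Cs] by (auto intro!: order_tendstoD simp: l_def c_def)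
  then have ev: "\<forall>\<^sub>F n in sequentially. norm (Ls n) \<le> l \<and> norm (Cs n) \<le> c"
    by eventually_elim auto
  have L: "norm L \<le> l" and C: "norm C \<le> c"
    by (auto simp: l_def c_def)
  have xd: "\<forall>\<^sub>F n in sequentially. \<forall>t\<in>{0..T}. norm (xs n t - x t) \<le> e n"
    using ev
  proof eventually_elim
    case (elim n)
    then show ?case
      unfolding e_def a_def b_def d_def
      by (intro ballI norm_mild_solution_diff_le[OF S P x xs X Q L _ C]) auto
  qed
  then show "converges_in_C T xs x"
    unfolding converges_in_C_def using cx cxs uniform_limit_norm_bound[OF _ e0] by blast
  have "\<forall>\<^sub>F n in sequentially. \<forall>t\<in>{0..T}.
      norm (memory_state (Ls n) (Cs n) (xs n) t - memory_state L C x t)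
        \<le> exp (T * l) * c * (e n * T) + d n * T"
    using ev xd
  proof eventually_elim
    case (elim n)
    show ?case
    proof
      fix t
      assume t: "t \<in> {0..T}"
      have "norm (memory_state (Ls n) (Cs n) (xs n) t - memory_state L C x t)
          \<le> exp (T * l) * c * (LINT s:{0..t}|lebesgue. norm (xs n s - x s)) + d n * T"
        unfolding d_def using elim by (intro norm_memory_state_diff_le cx cxs X L C t) auto
      also have "\<dots> \<le> exp (T * l) * c * (e n * T) + d n * T"
      proof (intro add_right_mono mult_left_mono)
        have "norm (LINT s:{0..t}|lebesgue. norm (xs n s - x s)) \<le> e n * (t - 0)"
          using elim t by (intro set_integral_norm_le_const continuous_intros
              continuous_on_subset[OF cx] continuous_on_subset[OF cxs]) auto
        also have "\<dots> \<le> e n * T"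
          using t order_trans[OF norm_ge_zero elim(2)[rule_format, OF t]]
          by (intro mult_left_mono) auto
        finally show "(LINT s:{0..t}|lebesgue. norm (xs n s - x s)) \<le> e n * T"
          by simp
      qed (use \<open>0 \<le> c\<close> in simp)
      finally show "norm (memory_state (Ls n) (Cs n) (xs n) t - memory_state L C x t)
        \<le> exp (T * l) * c * (e n * T) + d n * T" .
    qed
  qed
  moreover have "(\<lambda>n. exp (T * l) * c * (e n * T) + d n * T) \<longlonglongrightarrow> 0"
    by (intro null d0 e0)
  ultimately have "uniform_limit {0..T} (\<lambda>n. memory_state (Ls n) (Cs n) (xs n))
      (memory_state L C x) sequentially"
    by (rule uniform_limit_norm_bound)
  then show "converges_in_C T (\<lambda>n. memory_state (Ls n) (Cs n) (xs n)) (memory_state L C x)"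
    unfolding converges_in_C_def using continuous_on_memory_state cx cxs T by blast
qed

theorem theorem5p11:
  fixes Ls :: "nat \<Rightarrow> ('u::{real_inner,banach,second_countable_topology} \<Rightarrow>\<^sub>L 'u)"
    and L :: "'u \<Rightarrow>\<^sub>L 'u"
    and Cs :: "nat \<Rightarrow> ('r::{real_inner,banach,second_countable_topology} \<Rightarrow>\<^sub>L 'u)"
    and C :: "'r \<Rightarrow>\<^sub>L 'u"
    and D :: "'r set" and A :: "'r \<Rightarrow> 'r" and S :: "real \<Rightarrow> ('r \<Rightarrow>\<^sub>L 'r)"
    and M \<omega> T :: real
    and F :: "real \<Rightarrow> 'r" and x0 :: 'r
    and xs :: "nat \<Rightarrow> real \<Rightarrow> 'r" and x :: "real \<Rightarrow> 'r"
    and qs :: "nat \<Rightarrow> real \<Rightarrow> 'u" and q :: "real \<Rightarrow> 'u"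
  assumes "\<And>n. selfadjoint_nonneg (Ls n)" and "selfadjoint_nonneg L"
    and "(\<lambda>n. norm (Ls n - L)) \<longlonglongrightarrow> 0" and "(\<lambda>n. norm (Cs n - C)) \<longlonglongrightarrow> 0"
    and "generates D A S"
    and "M \<ge> 1" and "\<And>t. t \<ge> 0 \<Longrightarrow> norm (S t) \<le> M * exp (\<omega> * t)"
    and "T > 0"
    and "set_integrable lebesgue {0<..<T} F"
    and "\<And>n. mild_solution S (memory_kernel (Ls n) (Cs n)) F x0 T (xs n)"
    and "mild_solution S (memory_kernel L C) F x0 T x"
  defines "qs \<equiv> (\<lambda>n. memory_state (Ls n) (Cs n) (xs n))" and "q \<equiv> memory_state L C x"
  shows "structure_preserving_stable_reduction S F x0 T Ls Cs L C
    \<and> converges_in_C T xs x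
    \<and> converges_in_C T qs q
    \<and> (\<lambda>n. 1 / 2 * (norm (qs n T))\<^sup>2
          + (LINT t:{0..T}|lebesgue. (norm (blinfun_apply (op_sqrt (Ls n)) (qs n t)))\<^sup>2))
        \<longlonglongrightarrow> 1 / 2 * (norm (q T))\<^sup>2
          + (LINT t:{0..T}|lebesgue. (norm (blinfun_apply (op_sqrt L) (q t)))\<^sup>2)"
proof -
  have S: "C0_semigroup S"
    using assms(5) unfolding generates_def by blast
  have Ls: "Ls \<longlonglongrightarrow> L" and Cs: "Cs \<longlonglongrightarrow> C"
    using assms(3,4) by (auto intro: LIM_zero_cancel tendsto_norm_zero_cancel)
  \<comment> \<open>The absolute value yields one constant on the whole interval, whatever the sign
    of \<open>\<omega>\<close>.\<close>
  have P: "norm (S s) \<le> M * exp (\<bar>\<omega>\<bar> * T)" if "s \<in> {0..T}" for s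
  proof -
    have "\<omega> * s \<le> \<bar>\<omega>\<bar> * T"
      using that by (intro mult_mono) auto
    then have "M * exp (\<omega> * s) \<le> M * exp (\<bar>\<omega>\<bar> * T)"
      using assms(6) by (intro mult_left_mono) auto
    then show ?thesis
      using assms(7)[of s] that by auto
  qed
  \<comment> \<open>Arbitrary \<open>ys\<close> and \<open>y\<close> are taken because the
    definition quantifies over all representatives; the given \<open>xs\<close> and \<open>x\<close>
    then witness its existence clauses.\<close>
  have conv: "converges_in_C T ys y \<and>
      converges_in_C T (\<lambda>n. memory_state (Ls n) (Cs n) (ys n)) (memory_state L C y) \<and>
      (\<lambda>n. storage_dissipation (Ls n) T (memory_state (Ls n) (Cs n) (ys n)))
        \<longlonglongrightarrow> storage_dissipation L T (memory_state L C y)"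
    if "\<And>n. mild_solution S (memory_kernel (Ls n) (Cs n)) F x0 T (ys n)"
      and "mild_solution S (memory_kernel L C) F x0 T y" for ys y
    using mild_solutions_converge[OF S P _ Ls Cs that] assms(1,2,8) Ls
    by (auto intro!: storage_dissipation_tendsto)
  have "structure_preserving_stable_reduction S F x0 T Ls Cs L C"
    unfolding structure_preserving_stable_reduction_def
    using assms(1,2,10,11) conv by (blast intro: adjoint_pair_adjoint)
  with conv[OF assms(10,11)] show ?thesis
    unfolding qs_def q_def storage_dissipation_def by blast
qed

end
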